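(* Let $L\ge 1$ and let $\gamma_1,\dots,\gamma_L$ be independent random variables, where $\gamma_\ell$ follows the Fisher-Snedecor $\mathcal{F}$ distribution with parameters $(\bar\gamma_\ell, m_\ell, m_{s_\ell})$, $\bar\gamma_\ell>0$, $m_\ell>0$, $m_{s_\ell}>1$. Let $Z=\gamma_1+\cdots+\gamma_L$ and set $x_\ell=\frac{m_\ell}{(m_{s_\ell}-1)\bar\gamma_\ell}$. Then for $z>0$ the probability density function of $Z$ is $$f_Z(z)=\frac{1}{z\prod_{\ell=1}^L\Gamma(m_\ell)\Gamma(m_{s_\ell})}\,H_{0,1:2,1;2,1;\cdots;2,1}^{0,0:1,2;1,2;\cdots;1,2}\left(\left.\begin{array}{c}x_1 z\\ \vdots\\ x_L z\end{array}\right|\begin{array}{c} - :(1,1),(1-m_{s_1},1);\cdots;(1,1),(1-m_{s_L},1)\\ (1;1,\dots,1):(m_1,1);\cdots;(m_L,1)\end{array}\right).$$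
   Context: The Fisher-Snedecor $\mathcal{F}$ distribution with parameters $(\bar\gamma,m,m_s)$, $\bar\gamma>0$, $m>0$, $m_s>1$, is the distribution on $(0,\infty)$ with density $f(\gamma)=\frac{m^m(m_s-1)^{m_s}\bar\gamma^{m_s}\gamma^{m-1}}{B(m,m_s)\,(m\gamma+(m_s-1)\bar\gamma)^{m+m_s}}$, where $B$ is the beta function. Multivariate Fox $H$-function: for $r$ complex variables, $$H_{p,q:p_1,q_1;\dots;p_r,q_r}^{0,n:m_1,n_1;\dots;m_r,n_r}\left(\left.\begin{array}{c}z_1\\ \vdots\\ z_r\end{array}\right|\begin{array}{c}(a_j;\alpha_j^{(1)},\dots,\alpha_j^{(r)})_{1,p}:(c_j^{(1)},\gamma_j^{(1)})_{1,p_1};\cdots;(c_j^{(r)},\gamma_j^{(r)})_{1,p_r}\\ (b_j;\beta_j^{(1)},\dots,\beta_j^{(r)})_{1,q}:(d_j^{(1)},\delta_j^{(1)})_{1,q_1};\cdots;(d_j^{(r)},\delta_j^{(r)})_{1,q_r}\end{array}\right)=\frac{1}{(2\pi i)^r}\int_{L_1}\!\!\cdots\!\int_{L_r}\Psi(\zeta_1,\dots,\zeta_r)\prod_{k=1}^r\phi_k(\zeta_k)z_k^{\zeta_k}\,d\zeta_1\cdots d\zeta_r,$$ with $\Psi=\frac{\prod_{j=1}^n\Gamma(1-a_j+\sum_k\alpha_j^{(k)}\zeta_k)}{\prod_{j=n+1}^p\Gamma(a_j-\sum_k\alpha_j^{(k)}\zeta_k)\prod_{j=1}^q\Gamma(1-b_j+\sum_k\beta_j^{(k)}\zeta_k)}$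 and $\phi_k(\zeta)=\frac{\prod_{\lambda=1}^{m_k}\Gamma(d_\lambda^{(k)}-\delta_\lambda^{(k)}\zeta)\prod_{j=1}^{n_k}\Gamma(1-c_j^{(k)}+\gamma_j^{(k)}\zeta)}{\prod_{j=n_k+1}^{p_k}\Gamma(c_j^{(k)}-\gamma_j^{(k)}\zeta)\prod_{\lambda=m_k+1}^{q_k}\Gamma(1-d_\lambda^{(k)}+\delta_\lambda^{(k)}\zeta)}$; the $L_k$ are the standard Mellin–Barnes contours (vertical lines separating the poles of the $\Gamma(d-\delta\zeta)$ factors from those of the $\Gamma(1-c+\gamma\zeta)$ and $\Gamma(1-a+\sum\alpha\zeta)$ factors, chosen so the integral converges). A "$-$" denotes an empty parameter list. Here each $c$-list is written $(c_1,\gamma_1),(c_2,\gamma_2)$ and each $d$-list $(d_1,\delta_1)$. *)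

theory Defs
  imports "HOL-Probability.Probability"
begin

definition fisher_snedecor_density :: "real \<Rightarrow> real \<Rightarrow> real \<Rightarrow> real \<Rightarrow> real" where
  "fisher_snedecor_density gb m ms g =
     (if g > 0 then
        m powr m * (ms - 1) powr ms * gb powr ms * g powr (m - 1)
        / (Beta m ms * (m * g + (ms - 1) * gb) powr (m + ms))
      else 0)"

text \<open>Multivariate Fox H-function in r variables (indexed 0..<r).
  Parameters:
   n          : number of leading (a_j) entries appearing in the numerator of Psi
   a          : list of (a_j, alpha_j), alpha_j k = alpha_j^(k), length p
   b          : list of (b_j, beta_j), length q
   mk k, nk k : the integers m_k, n_k
   cs k       : list of (c_j^(k), gamma_j^(k)), length p_k
   ds k       : list of (d_j^(k), delta_j^(k)), length q_k
   zs k       : the variable z_k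
   cc k       : abscissa of the vertical contour L_k = cc k + i R.\<close>

definition foxH_Psi ::
  "nat \<Rightarrow> nat \<Rightarrow> (complex \<times> (nat \<Rightarrow> real)) list \<Rightarrow> (complex \<times> (nat \<Rightarrow> real)) list
   \<Rightarrow> (nat \<Rightarrow> complex) \<Rightarrow> complex" where
  "foxH_Psi r n a b \<zeta> =
     (\<Prod>j<n. Gamma (1 - fst (a!j) + (\<Sum>k<r. of_real (snd (a!j) k) * \<zeta> k)))
     / ((\<Prod>j\<in>{n..<length a}. Gamma (fst (a!j) - (\<Sum>k<r. of_real (snd (a!j) k) * \<zeta> k)))
        * (\<Prod>j<length b. Gamma (1 - fst (b!j) + (\<Sum>k<r. of_real (snd (b!j) k) * \<zeta> k))))"

definition foxH_phi ::
  "nat \<Rightarrow> nat \<Rightarrow> (complex \<times> real) list \<Rightarrow> (complex \<times> real) list \<Rightarrow> complex \<Rightarrow> complex" where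
  "foxH_phi m n cs ds \<zeta> =
     (\<Prod>l<m. Gamma (fst (ds!l) - of_real (snd (ds!l)) * \<zeta>))
     * (\<Prod>j<n. Gamma (1 - fst (cs!j) + of_real (snd (cs!j)) * \<zeta>))
     / ((\<Prod>j\<in>{n..<length cs}. Gamma (fst (cs!j) - of_real (snd (cs!j)) * \<zeta>))
        * (\<Prod>l\<in>{m..<length ds}. Gamma (1 - fst (ds!l) + of_real (snd (ds!l)) * \<zeta>)))"

text \<open>The integral over L_1 x ... x L_r, parametrised by zeta_k = cc k + i t_k, t in R^r,
  so d zeta_k = i d t_k.  Complex powers are principal (z powr w = exp (w * Ln z)).\<close>
definition foxH ::
  "nat \<Rightarrow> nat \<Rightarrow> (complex \<times> (nat \<Rightarrow> real)) list \<Rightarrow> (complex \<times> (nat \<Rightarrow> real)) list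
   \<Rightarrow> (nat \<Rightarrow> nat) \<Rightarrow> (nat \<Rightarrow> nat) \<Rightarrow> (nat \<Rightarrow> (complex \<times> real) list) \<Rightarrow> (nat \<Rightarrow> (complex \<times> real) list)
   \<Rightarrow> (nat \<Rightarrow> complex) \<Rightarrow> (nat \<Rightarrow> real) \<Rightarrow> complex" where
  "foxH r n a b mk nk cs ds zs cc =
     (1 / (2 * of_real pi * \<i>)) ^ r *
     integral\<^sup>L (PiM {..<r} (\<lambda>_. lborel))
       (\<lambda>t. let \<zeta> = (\<lambda>k. complex_of_real (cc k) + \<i> * complex_of_real (t k)) in
            foxH_Psi r n a b \<zeta> * (\<Prod>k<r. foxH_phi (mk k) (nk k) (cs k) (ds k) (\<zeta> k) * zs k powr \<zeta> k)
            * \<i> ^ r)"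

end

theory Submission
  imports Defs
begin

text \<open>
  By Mellin inversion, each density is a superposition
  \<open>f(y) = \<integral> h(\<zeta>) y\<^bsup>\<zeta>-1\<^esup> d\<zeta>\<close> of powers over a vertical line, where \<open>h\<close> is the product
  \<open>x\<^bsup>\<zeta>\<^esup> \<Gamma>(m-\<zeta>) \<Gamma>(m\<^sub>s+\<zeta>)\<close> up to a constant. Convolving two powers gives a power again, times a Beta
  factor: \<open>y\<^bsup>\<zeta>-1\<^esup> * y\<^bsup>\<omega>-1\<^esup> = B(\<zeta>,\<omega>) y\<^bsup>\<zeta>+\<omega>-1\<^esup>\<close>. The Beta factors telescope to
  \<open>\<Prod>\<Gamma>(\<zeta>\<^sub>k) / \<Gamma>(\<Sum>\<zeta>\<^sub>k)\<close>, which is the missing part of the Fox H integrand.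
  Absolute convergence never needs Stirling's formula: \<open>|B(a,b)| \<le> B(Re a, Re b)\<close> handles the Beta factors,
  and \<open>ab B(a,b) = (a+b)(a+b+1) B(a+1,b+1)\<close> shows that \<open>h\<close> is \<open>O(1/t\<^sup>2)\<close>.
\<close>

subsection \<open>Beta integrals\<close>

text \<open>On a real base the principal logarithm is given by cases on the sign. Each case is
  measurable jointly in base and exponent, so the branch cut of \<open>Ln\<close> causes no
  trouble.\<close>

lemma measurable_of_real_powr [measurable (raw)]:
  assumes [measurable]: "f \<in> borel_measurable M" "g \<in> borel_measurable M"
  shows "(\<lambda>x. complex_of_real (f x) powr g x) \<in> borel_measurable M"
proof -
  have "complex_of_real y powr c = (if y = 0 then 0 else
          exp (c * (of_real (ln \<bar>y\<bar>) + (if y < 0 then of_real pi * \<i> else 0))))" for y c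
    using Ln_of_real'[of y] by (auto simp: powr_def)
  thus ?thesis by simp
qed

text \<open>In logarithmic coordinates the Gamma--Beta identity needs only translations and Fubini.\<close>

lemma Gamma_exp_integral:
  assumes "Re z > 0"
  shows "has_bochner_integral lborel (\<lambda>u. exp (z * of_real u - of_real (exp u))) (Gamma z)"
proof -
  let ?f = "\<lambda>t. complex_of_real t powr (z - 1) / of_real (exp t)"
  have "?f absolutely_integrable_on {0<..} \<and> integral {0<..} ?f = Gamma z"
    using absolutely_integrable_Gamma_integral'[OF assms] Gamma_integral_complex'[OF assms]
    by (auto simp: integral_unique)
  also have "{0<..} = exp ` (UNIV :: real set)"
    by (auto simp: image_iff) (metis exp_ln)
  also have "?f absolutely_integrable_on exp ` UNIV \<and> integral (exp ` UNIV) ?f = Gamma z \<longleftrightarrow>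
     (\<lambda>u. \<bar>exp u\<bar> *\<^sub>R ?f (exp u)) absolutely_integrable_on UNIV \<and>
        integral UNIV (\<lambda>u. \<bar>exp u\<bar> *\<^sub>R ?f (exp u)) = Gamma z"
    by (rule has_absolute_integral_change_of_variables_real [symmetric])
       (auto intro!: derivative_eq_intros inj_onI)
  also have "(\<lambda>u. \<bar>exp u\<bar> *\<^sub>R ?f (exp u)) = (\<lambda>u. exp (z * of_real u - of_real (exp u)))"
    by (rule ext) (simp add: powr_def scaleR_conv_of_real exp_of_real exp_diff exp_add
        algebra_simps flip: exp_of_real)
  finally have *: "(\<lambda>u. exp (z * of_real u - of_real (exp u))) absolutely_integrable_on UNIV"
    "integral UNIV (\<lambda>u. exp (z * of_real u - of_real (exp u))) = Gamma z" by auto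
  \<comment> \<open>\<open>absolutely_integrable_on\<close> refers to the completed Lebesgue
    measure; the integrand is Borel measurable, so integrability passes to
    \<open>lborel\<close>.\<close>
  have i: "integrable lborel (\<lambda>u. exp (z * complex_of_real u - of_real (exp u)))"
    using *(1) unfolding set_integrable_def by (subst (asm) integrable_completion) auto
  moreover have "integral\<^sup>L lborel (\<lambda>u. exp (z * complex_of_real u - of_real (exp u))) = Gamma z"
    using has_integral_integral_lborel[OF i] *(2) by (metis integral_unique)
  ultimately show ?thesis by (simp add: has_bochner_integral_iff)
qed

lemma has_bochner_integral_translate:
  fixes f :: "real \<Rightarrow> 'a :: {banach, second_countable_topology}"
  assumes "has_bochner_integral lborel f x"
  shows "has_bochner_integral lborel (\<lambda>s. f (s + v)) x"
  using assms lborel_has_bochner_integral_real_affine_iff[of 1 f x v] by (simp add: add.commute)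

text \<open>The double integral of \<open>g a (s + v) * g b v\<close> is evaluated in both orders.
  Integrating over \<open>s\<close> first gives \<open>Gamma a * Gamma b\<close>; integrating over
  \<open>v\<close> first gives the logistic weight times \<open>Gamma (a + b)\<close>.\<close>

lemma Beta_logistic_integral:
  assumes "Re a > 0" "Re b > 0"
  shows "has_bochner_integral lborel
           (\<lambda>s. exp (a * of_real s - (a + b) * of_real (ln (1 + exp s)))) (Beta a b)"
proof -
  define g where "g = (\<lambda>z u. exp (z * complex_of_real u - of_real (exp u)))"
  have [measurable]: "g z \<in> borel_measurable borel" for z
    unfolding g_def by measurable
  have g: "has_bochner_integral lborel (g z) (Gamma z)" if "Re z > 0" for z
    using Gamma_exp_integral[OF that] by (simp add: g_def)
  define H where "H = (\<lambda>v s. g a (s + v) * g b v)"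
  have Hs: "has_bochner_integral lborel (H v) (Gamma a * g b v)" for v
    unfolding H_def by (intro has_bochner_integral_mult_left has_bochner_integral_translate g assms)
  have Hv: "has_bochner_integral lborel (\<lambda>v. H v s)
      (exp (a * of_real s - (a + b) * of_real (ln (1 + exp s))) * Gamma (a + b))" for s
  proof -
    have "H v s = exp (a * of_real s - (a + b) * of_real (ln (1 + exp s))) *
              g (a + b) (v + ln (1 + exp s))" for v
    proof -
      \<comment> \<open>The two exponentials merge into one, so for fixed \<open>s\<close> the
        product is a single Gamma integrand with parameter \<open>a + b\<close>, translated by
        \<open>ln (1 + exp s)\<close>.\<close>
      have "exp (s + v) + exp v = exp (v + ln (1 + exp s))"
        by (simp add: exp_add algebra_simps add_pos_pos)
      hence "complex_of_real (exp (v + ln (1 + exp s))) = of_real (exp (s + v)) + of_real (exp v)"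
        by (metis of_real_add)
      thus ?thesis
        unfolding H_def g_def exp_add [symmetric]
        by (intro arg_cong[where f = exp]) (simp add: algebra_simps)
    qed
    thus ?thesis
      using assms
      by (auto intro!: has_bochner_integral_mult_right has_bochner_integral_translate g)
  qed
  have int: "integrable (lborel \<Otimes>\<^sub>M lborel) (\<lambda>(v, s). H v s)"
  proof (rule lborel_pair.Fubini_integrable)
    show "(\<lambda>(v, s). H v s) \<in> borel_measurable (lborel \<Otimes>\<^sub>M lborel)"
      unfolding H_def by measurable
    \<comment> \<open>The norm of \<open>H\<close> has the same product structure, so its iterated
      integral is a finite product and Fubini applies.\<close>
    have "has_bochner_integral lborel (\<lambda>s. norm (H v s)) ((\<integral>u. norm (g a u) \<partial>lborel) * norm (g b v))" for v
      unfolding H_def norm_mult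
      by (intro has_bochner_integral_mult_left has_bochner_integral_translate
           has_bochner_integral_integrable integrable_norm)
         (use g[of a] assms in \<open>auto simp: has_bochner_integral_iff\<close>)
    hence "(\<lambda>v. \<integral>s. norm (H v s) \<partial>lborel) = (\<lambda>v. (\<integral>u. norm (g a u) \<partial>lborel) * norm (g b v))"
      by (simp add: has_bochner_integral_iff)
    moreover have "integrable lborel (g b)"
      using g[of b] assms by (auto simp: has_bochner_integral_iff)
    ultimately show "integrable lborel (\<lambda>v. \<integral>s. norm (case (v, s) of (v, s) \<Rightarrow> H v s) \<partial>lborel)"
      by simp
    show "AE v in lborel. integrable lborel (\<lambda>s. case (v, s) of (v, s) \<Rightarrow> H v s)"
      using Hs by (auto simp: has_bochner_integral_iff)
  qed
  have nz: "Gamma (a + b) \<noteq> 0"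
    using assms by (auto simp: Gamma_eq_zero_iff elim!: nonpos_Ints_cases dest!: arg_cong[where f = Re])
  have "has_bochner_integral lborel (\<lambda>s. \<integral>v. H v s \<partial>lborel) (\<integral>v. \<integral>s. H v s \<partial>lborel \<partial>lborel)"
    using lborel_pair.integrable_snd[OF int] lborel_pair.Fubini_integral[OF int]
    by (simp add: has_bochner_integral_iff)
  also have "(\<lambda>s. \<integral>v. H v s \<partial>lborel) =
      (\<lambda>s. exp (a * of_real s - (a + b) * of_real (ln (1 + exp s))) * Gamma (a + b))"
    using Hv by (simp add: has_bochner_integral_iff)
  also have "(\<integral>v. \<integral>s. H v s \<partial>lborel \<partial>lborel) = Gamma a * Gamma b"
    using Hs g[of b] assms by (simp add: has_bochner_integral_iff)
  finally have "has_bochner_integral lborel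
     (\<lambda>s. exp (a * of_real s - (a + b) * of_real (ln (1 + exp s))) * Gamma (a + b) / Gamma (a + b))
     (Gamma a * Gamma b / Gamma (a + b))"
    by (rule has_bochner_integral_divide_zero)
  thus ?thesis using nz by (simp add: Beta_def)
qed

text \<open>The integrand of the logistic Beta integral is an exponential, whose modulus is the same
  integrand with \<open>a\<close> and \<open>b\<close> replaced by their real parts. The bound is
  the triangle inequality for integrals.\<close>

lemma norm_Beta_le:
  assumes "Re a > 0" "Re b > 0"
  shows "norm (Beta a b) \<le> Beta (Re a) (Re b)"
proof -
  let ?f = "\<lambda>a b s. exp (a * of_real s - (a + b) * complex_of_real (ln (1 + exp s)))"
  have 1: "has_bochner_integral lborel (?f a b) (Beta a b)"
    using assms by (rule Beta_logistic_integral)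
  have "has_bochner_integral lborel (?f (Re a) (Re b)) (of_real (Beta (Re a) (Re b)))"
    using Beta_logistic_integral[of "Re a" "Re b"] assms
    by (simp add: Beta_def Gamma_complex_of_real flip: of_real_add)
  also have "?f (Re a) (Re b) = (\<lambda>s. complex_of_real (norm (?f a b s)))"
    by (rule ext) (simp flip: exp_of_real)
  finally have 2: "has_bochner_integral lborel (\<lambda>s. norm (?f a b s)) (Beta (Re a) (Re b))"
    by (drule_tac has_bochner_integral_bounded_linear[OF bounded_linear_Re]) simp
  have "norm (integral\<^sup>L lborel (?f a b)) \<le> (\<integral>s. norm (?f a b s) \<partial>lborel)"
    by (rule integral_norm_bound)
  thus ?thesis using 1 2 by (simp only: has_bochner_integral_iff)
qed

text \<open>The substitution y = z e^s / (1 + e^s) maps the real line onto (0, z) and turns the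
  convolution into the logistic Beta integral; the powers of \<open>z\<close> collect to the
  exponent \<open>a + b - 1\<close>.\<close>

lemma Beta_convolution_integral:
  assumes "Re a > 0" "Re b > 0" "z > 0"
  shows "has_bochner_integral lborel
           (\<lambda>y. indicator {0<..<z} y *\<^sub>R (of_real y powr (a - 1) * of_real (z - y) powr (b - 1)))
           (Beta a b * of_real z powr (a + b - 1))"
proof -
  let ?f = "\<lambda>y. complex_of_real y powr (a - 1) * of_real (z - y) powr (b - 1)"
  let ?g = "\<lambda>s :: real. z * exp s / (1 + exp s)"
  let ?h = "\<lambda>s :: real. z * exp s / (1 + exp s)\<^sup>2"
  let ?F = "\<lambda>s. of_real z powr (a + b - 1) *
               exp (a * complex_of_real s - (a + b) * of_real (ln (1 + exp s)))"
  have pos: "1 + exp s > (0 :: real)" for s by (simp add: add_pos_pos)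
  have nz: "1 + exp s \<noteq> (0 :: real)" for s using pos[of s] by linarith
  \<comment> \<open>\<open>?h\<close> is the derivative of \<open>?g\<close>. Each factor is written
    as one exponential, which reduces the identity to a linear one between exponents.\<close>
  have eq: "\<bar>?h s\<bar> *\<^sub>R ?f (?g s) = ?F s" for s
  proof -
    have 1: "z - ?g s = z / (1 + exp s)" using nz[of s] by (simp add: field_simps)
    have 2: "of_real (?g s) powr c = exp (c * complex_of_real (ln z + s - ln (1 + exp s)))" for c
    proof -
      have "ln (?g s) = ln z + s - ln (1 + exp s)"
        using pos[of s] assms by (simp add: ln_div ln_mult)
      thus ?thesis using pos[of s] assms nz[of s]
        by (simp add: powr_def Ln_of_real del: of_real_divide of_real_mult of_real_add)
    qed
    have 3: "of_real (z / (1 + exp s)) powr c = exp (c * complex_of_real (ln z - ln (1 + exp s)))" for c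
    proof -
      have "ln (z / (1 + exp s)) = ln z - ln (1 + exp s)"
        using pos[of s] assms by (simp add: ln_div)
      thus ?thesis using pos[of s] assms nz[of s]
        by (simp add: powr_def Ln_of_real del: of_real_divide of_real_mult of_real_add)
    qed
    have 4: "complex_of_real \<bar>?h s\<bar> = exp (complex_of_real (ln z + s - 2 * ln (1 + exp s)))"
    proof -
      have "\<bar>?h s\<bar> = exp (ln z + s - 2 * ln (1 + exp s))"
        using pos[of s] assms by (simp add: exp_add exp_diff exp_double)
      thus ?thesis by (simp only: exp_of_real)
    qed
    have 5: "complex_of_real z powr (a + b - 1) = exp ((a + b - 1) * of_real (ln z))"
      using assms by (simp add: powr_def Ln_of_real)
    show ?thesis
      unfolding 1 scaleR_conv_of_real 2 3 4 5 exp_add [symmetric]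
      by (intro arg_cong[where f = exp]) (simp add: algebra_simps)
  qed
  have F: "has_bochner_integral lborel ?F (of_real z powr (a + b - 1) * Beta a b)"
    by (intro has_bochner_integral_mult_right Beta_logistic_integral assms)
  have "?F absolutely_integrable_on UNIV"
    using F unfolding set_integrable_def by (subst integrable_completion) (auto simp: has_bochner_integral_iff)
  moreover have "integral UNIV ?F = of_real z powr (a + b - 1) * Beta a b"
    using integral_unique[OF has_integral_integral_lborel[of ?F]] F
    by (simp only: has_bochner_integral_iff)
  ultimately have "(\<lambda>s. \<bar>?h s\<bar> *\<^sub>R ?f (?g s)) absolutely_integrable_on UNIV \<and>
     integral UNIV (\<lambda>s. \<bar>?h s\<bar> *\<^sub>R ?f (?g s)) = of_real z powr (a + b - 1) * Beta a b"
    unfolding eq by blast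
  also have "?this \<longleftrightarrow> ?f absolutely_integrable_on ?g ` UNIV \<and>
                integral (?g ` UNIV) ?f = of_real z powr (a + b - 1) * Beta a b"
  proof (rule has_absolute_integral_change_of_variables_real)
    show "(?g has_field_derivative ?h s) (at s within UNIV)" for s
      using nz[of s] assms by (auto intro!: derivative_eq_intros simp: field_simps power2_eq_square)
    show "inj_on ?g UNIV"
    proof (rule inj_onI)
      fix x y :: real assume "?g x = ?g y"
      hence "exp x = exp y" using nz[of x] nz[of y] assms by (simp add: field_simps)
      thus "x = y" by simp
    qed
  qed auto
  also have "?g ` UNIV = {0<..<z}"
  proof safe
    fix s show "?g s \<in> {0<..<z}" using pos[of s] assms by (simp add: field_simps)
  next
    fix y assume y: "y \<in> {0<..<z}"
    have "y = ?g (ln (y / (z - y)))" using y assms by (simp add: field_simps)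
    thus "y \<in> range ?g" by blast
  qed
  finally have *: "?f absolutely_integrable_on {0<..<z}"
    "integral {0<..<z} ?f = of_real z powr (a + b - 1) * Beta a b" by auto
  have m: "(\<lambda>x. indicat_real {0<..<z} x *\<^sub>R ?f x) \<in> borel_measurable borel"
    by measurable
  have i: "integrable lborel (\<lambda>x. indicat_real {0<..<z} x *\<^sub>R ?f x)"
    using *(1) m unfolding set_integrable_def by (subst (asm) integrable_completion) auto
  moreover have "set_lebesgue_integral lborel {0<..<z} ?f = integral {0<..<z} ?f"
    by (rule set_borel_integral_eq_integral) (use i in \<open>auto simp: set_integrable_def\<close>)
  ultimately show ?thesis using *(2)
    by (simp add: has_bochner_integral_iff set_lebesgue_integral_def mult.commute)
qed

subsection \<open>Fourier inversion\<close>

text \<open>Levy inversion is a limit over growing symmetric intervals. For an integrable integrand,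
  dominated convergence replaces this limit by the integral over the whole line.\<close>

lemma tendsto_integral_symmetric_interval:
  fixes G :: "real \<Rightarrow> complex"
  assumes "integrable lborel G"
  shows "(\<lambda>T::nat. CLBINT t=-real T..real T. G t) \<longlonglongrightarrow> (CLBINT t. G t)"
proof -
  have "(\<lambda>T::nat. CLBINT t. indicator {-real T<..<real T} t *\<^sub>R G t) \<longlonglongrightarrow> (CLBINT t. G t)"
  proof (rule integral_dominated_convergence[where w = "\<lambda>t. norm (G t)"])
    show "AE t in lborel. (\<lambda>T::nat. indicator {-real T<..<real T} t *\<^sub>R G t) \<longlonglongrightarrow> G t"
    proof (rule AE_I2)
      fix t :: real
      have "eventually (\<lambda>T::nat. \<bar>t\<bar> < real T) sequentially"
        using filterlim_real_sequentially filterlim_at_top_dense by blast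
      hence "eventually (\<lambda>T::nat. indicator {-real T<..<real T} t *\<^sub>R G t = G t) sequentially"
        by eventually_elim (auto simp: indicator_def)
      thus "(\<lambda>T::nat. indicator {-real T<..<real T} t *\<^sub>R G t) \<longlonglongrightarrow> G t"
        by (rule tendsto_eventually)
    qed
  qed (use assms in \<open>auto simp: indicator_def\<close>)
  moreover have "(CLBINT t. indicator {-real T<..<real T} t *\<^sub>R G t) = (CLBINT t=-real T..real T. G t)" for T :: nat
    by (simp add: interval_lebesgue_integral_def set_lebesgue_integral_def)
  ultimately show ?thesis by simp
qed

text \<open>Levy inversion gives the mass of an interval, and the density is recovered as a
  difference quotient. Integrability of \<open>\<phi>\<close> allows the limit under the integral;
  continuity of \<open>f\<close> gives the formula at every point rather than almost
  everywhere.\<close>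

lemma Fourier_inversion_density:
  fixes f :: "real \<Rightarrow> real" and \<phi> :: "real \<Rightarrow> complex"
  assumes nonneg: "\<And>x. f x \<ge> 0" and cont: "continuous_on UNIV f"
    and f1: "has_bochner_integral lborel f 1"
    and \<phi>: "\<And>t. \<phi> t = (CLBINT x. f x *\<^sub>R iexp (t * x))"
    and int: "integrable lborel \<phi>"
  shows "complex_of_real (f a) = (CLBINT t. iexp (-(t * a)) * \<phi> t) / (2 * pi)"
proof -
  define M where "M = density lborel (\<lambda>x. ennreal (f x))"
  have [measurable]: "f \<in> borel_measurable borel"
    using cont by (rule borel_measurable_continuous_onI)
  have intf: "integrable lborel f" and f_int: "integral\<^sup>L lborel f = 1"
    using f1 by (auto simp: has_bochner_integral_iff)
  have "emeasure M (space M) = 1"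
    unfolding M_def using nn_integral_eq_integral[OF intf] nonneg f_int
    by (simp add: emeasure_density)
  then interpret prob_space M by (rule prob_spaceI)
  interpret real_distribution M
    by unfold_locales (simp_all add: M_def)
  have char: "char M t = \<phi> t" for t
    unfolding char_def M_def \<phi> using nonneg by (subst integral_density) auto
  have meas: "measure M A = (LBINT x:A. f x)" if [measurable]: "A \<in> sets borel" for A
  proof -
    have "integrable lborel (\<lambda>x. indicator A x *\<^sub>R f x)"
      using intf by (rule integrable_mult_indicator[rotated]) auto
    moreover have "emeasure M A = (\<integral>\<^sup>+x. ennreal (indicator A x *\<^sub>R f x) \<partial>lborel)"
      unfolding M_def by (subst emeasure_density) (auto intro!: nn_integral_cong simp: indicator_def)
    ultimately show ?thesis
      using nonneg unfolding measure_def set_lebesgue_integral_def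
      by (simp add: nn_integral_eq_integral)
  qed
  \<comment> \<open>Levy inversion requires that the endpoints of the interval carry no
    mass.\<close>
  have sing: "measure M {x} = 0" for x
    by (auto simp: M_def emeasure_density measure_def nn_integral_0_iff_AE
         intro!: AE_mp[OF AE_lborel_singleton[of x]])
  \<comment> \<open>This is the Levy kernel of \<open>{a<..a+h}\<close>. Its modulus is at most the
    interval length \<open>h\<close>, uniformly in \<open>t\<close>, so \<open>F h t / h\<close> is
    bounded by 1. At \<open>t = 0\<close> division by zero makes it 0.\<close>
  define F where "F = (\<lambda>h t. (iexp (-(t * a)) - iexp (-(t * (a + h)))) / (\<i> * complex_of_real t))"
  have F_bound: "norm (F h t) \<le> h" if "h > 0" for h t
  proof (cases "t = 0")
    case False
    have e: "-(t * a) = t * -a" "-(t * (a + h)) = t * -(a + h)" by (simp_all add: algebra_simps)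
    show ?thesis
      using Levy_Inversion_aux2[of "-(a+h)" "-a" t] that False unfolding F_def e by simp
  qed (use that in \<open>auto simp: F_def\<close>)
  have [measurable]: "F h \<in> borel_measurable borel" for h
    unfolding F_def by measurable
  have eq: "complex_of_real (LBINT x:{a<..a+h}. f x) = (CLBINT t. F h t * \<phi> t) / (2 * pi)"
    if "h > 0" for h
  proof -
    have i: "integrable lborel (\<lambda>t. F h t * \<phi> t)"
      by (rule Bochner_Integration.integrable_bound[of _ "\<lambda>t. h * norm (\<phi> t)"])
         (use int that in \<open>auto simp: norm_mult intro!: mult_right_mono F_bound\<close>)
    have "(\<lambda>T::nat. 1 / (2 * pi) * (CLBINT t=-real T..real T. F h t * \<phi> t)) \<longlonglongrightarrow> 1 / (2 * pi) * (CLBINT t. F h t * \<phi> t)"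
      by (intro tendsto_intros tendsto_integral_symmetric_interval i)
    moreover have "(\<lambda>T::nat. 1 / (2 * pi) * (CLBINT t=-real T..real T. F h t * \<phi> t)) \<longlonglongrightarrow>
        complex_of_real (measure M {a<..a+h})"
      using Levy_Inversion[of a "a + h"] sing that unfolding char F_def by simp
    ultimately have "complex_of_real (measure M {a<..a+h}) = 1 / (2 * pi) * (CLBINT t. F h t * \<phi> t)"
      using LIMSEQ_unique by blast
    thus ?thesis by (simp add: meas)
  qed
  text \<open>Divide the Levy inversion formula on \<open>{a<..a+h}\<close> by \<open>h\<close> and let \<open>h\<close> tend to 0.\<close>
  define h where "h = (\<lambda>n. 1 / real (Suc n))"
  have h_pos: "h n > 0" for n by (simp add: h_def)
  have h_lim: "h \<longlonglongrightarrow> 0" unfolding h_def using LIMSEQ_inverse_real_of_nat by (simp add: inverse_eq_divide)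
  have "(\<lambda>n. (CLBINT t. F (h n) t / h n * \<phi> t)) \<longlonglongrightarrow> (CLBINT t. iexp (-(t * a)) * \<phi> t)"
  proof (rule integral_dominated_convergence[where w = "\<lambda>t. norm (\<phi> t)"])
    show "AE t in lborel. norm (F (h n) t / h n * \<phi> t) \<le> norm (\<phi> t)" for n
    proof (rule AE_I2)
      fix t
      have "norm (F (h n) t / h n) \<le> 1"
        using F_bound[of "h n" t] h_pos[of n] by (simp add: norm_divide)
      thus "norm (F (h n) t / h n * \<phi> t) \<le> norm (\<phi> t)"
        by (metis mult_left_le_one_le norm_ge_zero norm_mult)
    qed
    show "AE t in lborel. (\<lambda>n. F (h n) t / h n * \<phi> t) \<longlonglongrightarrow> iexp (-(t * a)) * \<phi> t"
    \<comment> \<open>The point \<open>t = 0\<close> is discarded because the quotient has the value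
      0 there instead of the limit 1.\<close>
    proof (rule AE_mp[OF AE_lborel_singleton[of 0]], rule AE_I2, rule impI)
      fix t :: real assume t: "t \<noteq> 0"
      have "((\<lambda>w. (1 - iexp (-w)) / (\<i> * w)) \<longlongrightarrow> 1) (at 0)"
        using Levy_Inversion_aux1[of 0 1] by simp
      moreover have "filterlim (\<lambda>n. t * h n) (at 0) sequentially"
        unfolding filterlim_at using t h_pos tendsto_mult_right_zero[OF h_lim, of t]
        by (auto simp: less_imp_neq[symmetric] intro!: always_eventually)
      ultimately have "(\<lambda>n. (1 - iexp (-(t * h n))) / (\<i> * complex_of_real (t * h n))) \<longlonglongrightarrow> 1"
        by (rule filterlim_compose)
      hence "(\<lambda>n. iexp (-(t * a)) * ((1 - iexp (-(t * h n))) / (\<i> * complex_of_real (t * h n))) * \<phi> t)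
              \<longlonglongrightarrow> iexp (-(t * a)) * 1 * \<phi> t"
        by (intro tendsto_intros)
      moreover have "iexp (-(t * a)) * ((1 - iexp (-(t * h n))) / (\<i> * complex_of_real (t * h n))) =
          F (h n) t / h n" for n
      proof -
        have "iexp (-(t * (a + h n))) = iexp (-(t * a)) * iexp (-(t * h n))"
          by (simp add: algebra_simps flip: exp_add)
        thus ?thesis unfolding F_def by (simp add: algebra_simps)
      qed
      ultimately show "(\<lambda>n. F (h n) t / h n * \<phi> t) \<longlonglongrightarrow> iexp (-(t * a)) * \<phi> t"
        by (simp only: mult_1_right)
    qed
  qed (use int in auto)
  hence "(\<lambda>n. (CLBINT t. F (h n) t / h n * \<phi> t) / (2 * pi)) \<longlonglongrightarrow> (CLBINT t. iexp (-(t * a)) * \<phi> t) / (2 * pi)"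
    by (intro tendsto_intros) auto
  also have "(\<lambda>n. (CLBINT t. F (h n) t / h n * \<phi> t) / (2 * pi)) =
      (\<lambda>n. complex_of_real ((LBINT x:{a<..a+h n}. f x) / h n))"
  proof
    fix n
    have "(CLBINT t. F (h n) t / h n * \<phi> t) = (CLBINT t. F (h n) t * \<phi> t) / h n"
      unfolding times_divide_eq_left by (rule integral_divide_zero)
    thus "(CLBINT t. F (h n) t / h n * \<phi> t) / (2 * pi) = of_real ((LBINT x:{a<..a+h n}. f x) / h n)"
      using eq[OF h_pos[of n]] by simp
  qed
  finally have 1: "(\<lambda>n. complex_of_real ((LBINT x:{a<..a+h n}. f x) / h n)) \<longlonglongrightarrow>
      (CLBINT t. iexp (-(t * a)) * \<phi> t) / (2 * pi)" .
  \<comment> \<open>The means over \<open>{a<..a+h n}\<close> tend to \<open>f a\<close> by the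
    fundamental theorem of calculus at the left endpoint; \<open>h n \<le> 1\<close> keeps the
    points \<open>a + h n\<close> inside \<open>{a..a+1}\<close>.\<close>
  have "((\<lambda>x. integral {a..x} f) has_real_derivative f a) (at a within {a..a+1})"
    by (rule integral_has_real_derivative) (auto intro: continuous_on_subset[OF cont])
  hence "((\<lambda>x. integral {a..x} f / (x - a)) \<longlongrightarrow> f a) (at a within {a..a+1})"
    by (simp add: has_field_derivative_iff)
  moreover have "filterlim (\<lambda>n. a + h n) (at a within {a..a+1}) sequentially"
    unfolding filterlim_at using tendsto_add[OF tendsto_const[of a] h_lim] h_pos
    by (auto simp: less_imp_neq[symmetric] h_def intro!: always_eventually)
  ultimately have "(\<lambda>n. integral {a..a + h n} f / (a + h n - a)) \<longlonglongrightarrow> f a"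
    by (rule filterlim_compose)
  moreover have "integral {a..a + h n} f = (LBINT x:{a<..a+h n}. f x)" for n
  proof -
    have "set_integrable lborel {a..a+h n} f"
      unfolding set_integrable_def using intf by (rule integrable_mult_indicator[rotated]) auto
    hence "integral {a..a + h n} f = (LBINT x:{a..a+h n}. f x)"
      by (rule set_borel_integral_eq_integral(2) [symmetric])
    also have "\<dots> = (LBINT x:{a<..a+h n}. f x)"
      unfolding set_lebesgue_integral_def
    proof (rule integral_cong_AE)
      show "AE x in lborel. indicator {a..a+h n} x *\<^sub>R f x = indicator {a<..a+h n} x *\<^sub>R f x"
        using AE_lborel_singleton[of a] by eventually_elim (auto simp: indicator_def)
    qed measurable
    finally show ?thesis .
  qed
  ultimately have "(\<lambda>n. (LBINT x:{a<..a+h n}. f x) / h n) \<longlonglongrightarrow> f a" by simp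
  hence "(\<lambda>n. complex_of_real ((LBINT x:{a<..a+h n}. f x) / h n)) \<longlonglongrightarrow> complex_of_real (f a)"
    by (rule tendsto_of_real)
  from LIMSEQ_unique[OF this 1] show ?thesis .
qed

subsection \<open>The Beta function on vertical lines\<close>

text \<open>\<open>Gamma\<close> is the inverse of the entire function \<open>rGamma\<close>, and
  \<open>inverse\<close> is Borel measurable, with value 0 at the poles of
  \<open>Gamma\<close>.\<close>

lemma borel_measurable_Gamma_complex [measurable]: "(Gamma :: complex \<Rightarrow> complex) \<in> borel_measurable borel"
proof -
  have [measurable]: "(rGamma :: complex \<Rightarrow> complex) \<in> borel_measurable borel"
    by (intro borel_measurable_continuous_onI continuous_intros)
  have eq: "Gamma = (\<lambda>z :: complex. inverse (rGamma z))"
    by (auto simp: Gamma_def)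
  show ?thesis unfolding eq by measurable
qed

lemma borel_measurable_Beta_complex [measurable (raw)]:
  fixes f g :: "'a \<Rightarrow> complex"
  assumes [measurable]: "f \<in> borel_measurable M" "g \<in> borel_measurable M"
  shows "(\<lambda>x. Beta (f x) (g x)) \<in> borel_measurable M"
  unfolding Beta_def by measurable

lemma Re_pos_not_nonpos_Int: "Re z > 0 \<Longrightarrow> z \<notin> \<int>\<^sub>\<le>\<^sub>0"
  by (auto elim!: nonpos_Ints_cases)

text \<open>The imaginary parts of the two arguments cancel, so their sum is the constant
  \<open>p + q\<close>. In the recurrence for \<open>a * b * Beta a b\<close> the right-hand side is
  therefore bounded, while the modulus of \<open>a * b\<close> grows like
  \<open>t\<^sup>2\<close>.\<close>

lemma integrable_Beta_vertical:
  assumes "p > 0" "q > 0"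
  shows "integrable lborel (\<lambda>t. Beta (of_real p - \<i> * of_real t) (of_real q + \<i> * of_real t))"
proof -
  \<comment> \<open>Both arguments have modulus at least
    \<open>min 1 (min p q) * sqrt (1 + t\<^sup>2)\<close>, so \<open>k * (1 + t\<^sup>2)\<close>
    bounds the product of the moduli from below. \<open>C\<close> bounds the other side of the
    recurrence, using \<open>norm_Beta_le\<close> for the shifted Beta value.\<close>
  define k where "k = (min 1 (min p q))\<^sup>2"
  define C where "C = (p + q) * (p + q + 1) * Beta (p + 1) (q + 1)"
  have "k > 0" using assms by (simp add: k_def)
  have bound: "norm (Beta (of_real p - \<i> * of_real t) (of_real q + \<i> * of_real t)) \<le> C / k * inverse (1 + t\<^sup>2)" for t
  proof -
    define a b where "a = complex_of_real p - \<i> * of_real t" and "b = complex_of_real q + \<i> * of_real t"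
    have Re: "Re a = p" "Re b = q" "a + b = of_real (p + q)" by (simp_all add: a_def b_def)
    have "norm w \<ge> min 1 (min p q) * sqrt (1 + t\<^sup>2)"
      if w: "w = a \<or> w = b" for w
    proof -
      have "min 1 (min p q) * sqrt (1 + t\<^sup>2) = sqrt (k * (1 + t\<^sup>2))"
        using assms by (simp add: k_def real_sqrt_mult)
      also have "k * (1 + t\<^sup>2) \<le> (Re w)\<^sup>2 + (Im w)\<^sup>2"
      proof -
        have "k \<le> (Re w)\<^sup>2" using w assms by (auto simp: k_def Re intro!: power_mono)
        moreover have "k \<le> 1" using assms by (auto simp: k_def intro!: power_le_one)
        hence "k * t\<^sup>2 \<le> t\<^sup>2" by (simp add: mult_left_le_one_le \<open>k > 0\<close> less_imp_le)
        moreover have "(Im w)\<^sup>2 = t\<^sup>2" using w by (auto simp: a_def b_def)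
        ultimately show ?thesis by (simp add: algebra_simps)
      qed
      finally show ?thesis by (simp add: cmod_def)
    qed
    hence "(min 1 (min p q) * sqrt (1 + t\<^sup>2)) * (min 1 (min p q) * sqrt (1 + t\<^sup>2)) \<le> norm a * norm b"
      using assms by (intro mult_mono) auto
    also have "(min 1 (min p q) * sqrt (1 + t\<^sup>2)) * (min 1 (min p q) * sqrt (1 + t\<^sup>2)) = k * (1 + t\<^sup>2)"
      unfolding k_def by (simp add: power2_eq_square algebra_simps flip: real_sqrt_mult)
    finally have ab: "k * (1 + t\<^sup>2) \<le> norm a * norm b" .
    have "a * b * Beta a b = b * ((a + b) * Beta (a + 1) b)"
      using Re assms by (subst Beta_plus1_left) (auto simp: Re_pos_not_nonpos_Int)
    also have "\<dots> = (a + b) * ((a + 1 + b) * Beta (a + 1) (b + 1))"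
      using Re assms by (subst Beta_plus1_right) (auto simp: Re_pos_not_nonpos_Int)
    finally have "norm (a * b * Beta a b) = norm ((a + b) * ((a + 1 + b) * Beta (a + 1) (b + 1)))"
      by simp
    also have "a + 1 + b = of_real (p + q + 1)" using Re(3) by (simp add: algebra_simps)
    finally have "norm a * norm b * norm (Beta a b) = (p + q) * (p + q + 1) * norm (Beta (a + 1) (b + 1))"
      unfolding Re(3) norm_mult norm_of_real using assms by (simp add: mult_ac)
    also have "\<dots> \<le> C"
      using norm_Beta_le[of "a + 1" "b + 1"] Re assms unfolding C_def
      by (intro mult_left_mono) auto
    finally have "k * (1 + t\<^sup>2) * norm (Beta a b) \<le> C"
      using mult_right_mono[OF ab, of "norm (Beta a b)"] by simp
    moreover have "k * (1 + t\<^sup>2) > 0" using \<open>k > 0\<close> by (simp add: add_pos_nonneg)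
    ultimately have "norm (Beta a b) \<le> C / (k * (1 + t\<^sup>2))"
      by (subst pos_le_divide_eq) (simp_all only: mult_ac)
    thus ?thesis by (simp add: a_def b_def divide_inverse mult_ac)
  qed
  show ?thesis
  proof (rule Bochner_Integration.integrable_bound)
    show "integrable lborel (\<lambda>t. C / k * inverse (1 + t\<^sup>2))"
      using integrable_inverse_1_plus_square by (simp add: set_integrable_def)
    show "AE t in lborel. norm (Beta (complex_of_real p - \<i> * of_real t) (of_real q + \<i> * of_real t))
              \<le> norm (C / k * inverse (1 + t\<^sup>2))"
      by (intro AE_I2 order_trans[OF bound]) (simp only: real_norm_def abs_ge_self)
  qed measurable
qed

text \<open>Divided by \<open>Beta p q\<close>, the left-hand side is the density of the logarithm
  of a beta prime variable. The logistic Beta integral with complex parameters is its characteristic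
  function, so Fourier inversion applies.\<close>

lemma Beta_vertical_inversion:
  assumes "p > 0" "q > 0"
  shows "complex_of_real (exp (p * s - (p + q) * ln (1 + exp s))) =
    (CLBINT t. iexp (t * s) * Beta (of_real p - \<i> * of_real t) (of_real q + \<i> * of_real t)) / (2 * pi)"
proof -
  define f where "f = (\<lambda>s. exp (p * s - (p + q) * ln (1 + exp s)) / Beta p q)"
  define B where "B = (\<lambda>t. Beta (complex_of_real p - \<i> * of_real t) (of_real q + \<i> * of_real t))"
  have Bpq: "Beta p q > 0" using assms by (simp add: Beta_def)
  have log: "has_bochner_integral lborel (\<lambda>x. Beta p q *\<^sub>R (f x *\<^sub>R iexp (t * x))) (B (-t))" for t
  proof -
    have eq: "Beta p q *\<^sub>R (f x *\<^sub>R iexp (t * x)) =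
       exp ((of_real p + \<i> * of_real t) * of_real x -
           (of_real p + \<i> * of_real t + (of_real q - \<i> * of_real t)) * of_real (ln (1 + exp x)))" for x
    proof -
      have "Beta p q *\<^sub>R (f x *\<^sub>R iexp (t * x)) =
         exp (of_real (p * x - (p + q) * ln (1 + exp x))) * iexp (t * x)"
        using Bpq by (simp add: f_def scaleR_conv_of_real flip: exp_of_real)
      also have "\<dots> = exp (of_real (p * x - (p + q) * ln (1 + exp x)) + \<i> * (t * x))"
        by (simp add: exp_add)
      finally show ?thesis by (simp add: algebra_simps)
    qed
    show ?thesis unfolding eq
      using Beta_logistic_integral[of "of_real p + \<i> * of_real t" "of_real q - \<i> * of_real t"] assms
      by (simp add: B_def)
  qed
  have \<phi>: "has_bochner_integral lborel (\<lambda>x. f x *\<^sub>R iexp (t * x)) (B (-t) / Beta p q)" for t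
    using has_bochner_integral_divide_zero[OF log[of t], of "of_real (Beta p q)"] Bpq
    by (simp add: scaleR_conv_of_real)
  have "complex_of_real (f s) = (CLBINT t. iexp (-(t * s)) * (B (-t) / Beta p q)) / (2 * pi)"
  proof (rule Fourier_inversion_density)
    show "f x \<ge> 0" for x using Bpq by (simp add: f_def)
    have "1 + exp x \<noteq> (0::real)" for x by (metis add_pos_pos exp_gt_zero less_irrefl zero_less_one)
    thus "continuous_on UNIV f"
      unfolding f_def using Bpq by (intro continuous_intros) auto
    \<comment> \<open>The characteristic function at 0 provides the total mass 1.\<close>
    have "B 0 = of_real (Beta p q)"
      by (simp add: B_def Beta_def Gamma_complex_of_real flip: of_real_add)
    hence "has_bochner_integral lborel (\<lambda>x. complex_of_real (f x)) 1"
      using \<phi>[of 0] Bpq by (simp add: scaleR_conv_of_real)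
    from has_bochner_integral_bounded_linear[OF bounded_linear_Re this]
    show "has_bochner_integral lborel f 1" by simp
    show "B (-t) / Beta p q = (CLBINT x. f x *\<^sub>R iexp (t * x))" for t
      using \<phi>[of t] by (simp add: has_bochner_integral_iff)
    have "integrable lborel (\<lambda>t. B (-t))"
      using integrable_Beta_vertical[OF assms] lborel_integrable_real_affine[of B "-1" 0]
      by (simp add: B_def)
    thus "integrable lborel (\<lambda>t. B (-t) / Beta p q)" by simp
  qed
  \<comment> \<open>Reflecting \<open>t\<close> exchanges the sign convention of the characteristic
    function for that of the vertical line.\<close>
  also have "(CLBINT t. iexp (-(t * s)) * (B (-t) / Beta p q)) = (CLBINT t. iexp (t * s) * B t) / Beta p q"
    using lborel_integral_real_affine[of "-1" "\<lambda>t. iexp (t * s) * B t" 0] by simp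
  finally have "complex_of_real (f s) * Beta p q = (CLBINT t. iexp (t * s) * B t) / (2 * pi)"
    using Bpq by (simp add: field_simps)
  thus ?thesis using Bpq by (simp add: f_def B_def)
qed

subsection \<open>Convolution of superpositions of powers\<close>

lemma (in pair_sigma_finite) has_bochner_integral_pair_mult:
  fixes f :: "'a \<Rightarrow> complex" and g :: "'b \<Rightarrow> complex"
  assumes f: "integrable M1 f" and g: "integrable M2 g"
  shows "has_bochner_integral (M1 \<Otimes>\<^sub>M M2) (\<lambda>(s, t). f s * g t) (integral\<^sup>L M1 f * integral\<^sup>L M2 g)"
proof -
  have [measurable]: "f \<in> borel_measurable M1" "g \<in> borel_measurable M2" using f g by auto
  have i: "integrable (M1 \<Otimes>\<^sub>M M2) (\<lambda>(s, t). f s * g t)"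
    by (rule Fubini_integrable) (use f g in \<open>auto simp: norm_mult\<close>)
  show ?thesis
    using integral_fst[OF i] i by (simp add: has_bochner_integral_iff)
qed

lemma norm_of_real_powr:
  assumes "y > 0"
  shows "norm (complex_of_real y powr w) = y powr Re w"
  using assms by (simp add: norm_powr_real_powr)

text \<open>\<open>S\<close> and \<open>T\<close> stay abstract so that \<open>S\<close> can be the
  product of the contours already treated and \<open>T\<close> the next contour. The proof is Fubini
  between \<open>y\<close> and the parameters: as \<open>Re (p s)\<close> and
  \<open>Re (q t)\<close> are constant, the norm of the integrand splits into a function of the
  parameters times a function of \<open>y\<close>.\<close>

lemma
  fixes a :: "'s \<Rightarrow> complex" and b :: "'t \<Rightarrow> complex"
  assumes "sigma_finite_measure S" "sigma_finite_measure T"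
    and a: "integrable S a" and b: "integrable T b"
    and [measurable]: "p \<in> borel_measurable S" "q \<in> borel_measurable T"
    and p: "\<And>s. Re (p s) = P" and q: "\<And>t. Re (q t) = Q"
    and PQ: "P > 0" "Q > 0"
  shows integrable_Beta_product: "integrable (S \<Otimes>\<^sub>M T) (\<lambda>(s, t). a s * b t * Beta (p s) (q t))"
    and Mellin_convolution: "z > 0 \<Longrightarrow> has_bochner_integral lborel
      (\<lambda>y. indicator {0<..<z} y *\<^sub>R ((\<integral>s. a s * of_real y powr (p s - 1) \<partial>S) *
                                     (\<integral>t. b t * of_real (z - y) powr (q t - 1) \<partial>T)))
      (\<integral>(s, t). a s * b t * Beta (p s) (q t) * of_real z powr (p s + q t - 1) \<partial>(S \<Otimes>\<^sub>M T))"
proof -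
  interpret S: sigma_finite_measure S by fact
  interpret T: sigma_finite_measure T by fact
  interpret ST: pair_sigma_finite S T ..
  interpret N: sigma_finite_measure "S \<Otimes>\<^sub>M T" by (rule sigma_finite_pair_measure) fact+
  interpret L: pair_sigma_finite lborel "S \<Otimes>\<^sub>M T" ..
  have [measurable]: "a \<in> borel_measurable S" "b \<in> borel_measurable T" using a b by auto
  have ab: "integrable (S \<Otimes>\<^sub>M T) (\<lambda>(s, t). a s * b t)"
    using ST.has_bochner_integral_pair_mult[OF a b] by (simp add: has_bochner_integral_iff)
  show "integrable (S \<Otimes>\<^sub>M T) (\<lambda>(s, t). a s * b t * Beta (p s) (q t))"
  proof (rule Bochner_Integration.integrable_bound)
    show "integrable (S \<Otimes>\<^sub>M T) (\<lambda>st. (case st of (s, t) \<Rightarrow> a s * b t) * of_real (Beta P Q))"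
      using ab by (intro integrable_mult_left)
    show "AE st in S \<Otimes>\<^sub>M T. norm (case st of (s, t) \<Rightarrow> a s * b t * Beta (p s) (q t))
             \<le> norm ((case st of (s, t) \<Rightarrow> a s * b t) * complex_of_real (Beta P Q))"
    proof (rule AE_I2, clarify)
      fix s t
      have "norm (Beta (p s) (q t)) \<le> \<bar>Beta P Q\<bar>"
        using norm_Beta_le[of "p s" "q t"] p[of s] q[of t] PQ by simp
      thus "norm (a s * b t * Beta (p s) (q t)) \<le> norm (a s * b t * complex_of_real (Beta P Q))"
        unfolding norm_mult norm_of_real by (intro mult_left_mono) auto
    qed
  qed measurable
  assume z: "z > 0"
  define k where "k = (\<lambda>y c d. indicator {0<..<z} y *\<^sub>R (complex_of_real y powr (c - 1) * of_real (z - y) powr (d - 1)))"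
  define G where "G = (\<lambda>y (s, t). a s * b t * k y (p s) (q t))"
  \<comment> \<open>On \<open>{0<..<z}\<close> both bases are positive, so the modulus of each power
    depends only on the real part of its exponent.\<close>
  have k_norm: "norm (k y c d) = norm (k y (Re c) (Re d))" for y c d
    by (auto simp: k_def norm_mult indicator_def norm_of_real_powr simp del: of_real_diff)
  have [measurable]: "(\<lambda>x. k (f x) (g x) (h x)) \<in> borel_measurable M"
    if [measurable]: "f \<in> borel_measurable M" "g \<in> borel_measurable M" "h \<in> borel_measurable M"
    for f g h and M :: "'x measure"
    unfolding k_def by measurable
  have G_norm: "norm (G y w) = norm (case w of (s, t) \<Rightarrow> a s * b t) * norm (k y P Q)" for y w
    by (cases w) (simp add: G_def norm_mult k_norm[of y "p _" "q _"] p q)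
  have G_meas [measurable]: "(\<lambda>(y, w). G y w) \<in> borel_measurable (lborel \<Otimes>\<^sub>M (S \<Otimes>\<^sub>M T))"
    unfolding G_def k_def by measurable
  have Gy: "integrable (S \<Otimes>\<^sub>M T) (G y)" for y
  proof (rule Bochner_Integration.integrable_bound)
    show "integrable (S \<Otimes>\<^sub>M T) (\<lambda>w. (case w of (s, t) \<Rightarrow> a s * b t) * k y P Q)"
      using ab by (intro integrable_mult_left)
    show "AE w in S \<Otimes>\<^sub>M T. norm (G y w) \<le> norm ((case w of (s, t) \<Rightarrow> a s * b t) * k y P Q)"
      by (simp add: G_norm norm_mult)
  qed (unfold G_def k_def, measurable)
  have kB: "has_bochner_integral lborel (\<lambda>y. k y c d) (Beta c d * of_real z powr (c + d - 1))"
    if "Re c > 0" "Re d > 0" for c d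
    unfolding k_def using Beta_convolution_integral[OF that z] .
  have G: "integrable (lborel \<Otimes>\<^sub>M (S \<Otimes>\<^sub>M T)) (\<lambda>(y, w). G y w)"
  proof (rule L.Fubini_integrable)
    have "integrable lborel (\<lambda>y. k y P Q)"
      using kB[of P Q] PQ by (simp add: has_bochner_integral_iff)
    thus "integrable lborel (\<lambda>y. \<integral>w. norm (case (y, w) of (y, w) \<Rightarrow> G y w) \<partial>(S \<Otimes>\<^sub>M T))"
      by (simp add: G_norm)
  qed (use Gy in auto)
  have "has_bochner_integral lborel (\<lambda>y. integral\<^sup>L (S \<Otimes>\<^sub>M T) (G y))
          (\<integral>w. (\<integral>y. G y w \<partial>lborel) \<partial>(S \<Otimes>\<^sub>M T))"
    using L.integrable_fst[OF G] L.Fubini_integral[OF G] by (simp add: has_bochner_integral_iff)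
  also have "(\<lambda>w. \<integral>y. G y w \<partial>lborel) =
      (\<lambda>(s, t). a s * b t * Beta (p s) (q t) * of_real z powr (p s + q t - 1))"
  proof (rule ext, clarify)
    fix s t
    have "has_bochner_integral lborel (\<lambda>y. a s * b t * k y (p s) (q t))
       (a s * b t * (Beta (p s) (q t) * of_real z powr (p s + q t - 1)))"
      using p q PQ by (intro has_bochner_integral_mult_right kB) auto
    thus "(\<integral>y. G y (s, t) \<partial>lborel) = a s * b t * Beta (p s) (q t) * of_real z powr (p s + q t - 1)"
      by (simp add: G_def has_bochner_integral_iff mult_ac)
  qed
  also have "(\<lambda>y. integral\<^sup>L (S \<Otimes>\<^sub>M T) (G y)) =
     (\<lambda>y. indicator {0<..<z} y *\<^sub>R ((\<integral>s. a s * of_real y powr (p s - 1) \<partial>S) *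
                                     (\<integral>t. b t * of_real (z - y) powr (q t - 1) \<partial>T)))"
  proof (rule ext)
    fix y
    show "integral\<^sup>L (S \<Otimes>\<^sub>M T) (G y) =
       indicator {0<..<z} y *\<^sub>R ((\<integral>s. a s * of_real y powr (p s - 1) \<partial>S) *
                                     (\<integral>t. b t * of_real (z - y) powr (q t - 1) \<partial>T))"
    proof (cases "y \<in> {0<..<z}")
      \<comment> \<open>For fixed \<open>y\<close> inside the interval the powers have constant
        modulus, so both factors are integrable and the integral over the pair splits into a
        product.\<close>
      case True
      have 1: "integrable S (\<lambda>s. a s * of_real y powr (p s - 1))"
        by (rule Bochner_Integration.integrable_bound[of _ "\<lambda>s. a s * of_real (y powr (P - 1))"])
           (use True a p in \<open>auto simp: norm_mult norm_of_real_powr\<close>)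
      have 2: "integrable T (\<lambda>t. b t * of_real (z - y) powr (q t - 1))"
        by (rule Bochner_Integration.integrable_bound[of _ "\<lambda>t. b t * of_real ((z - y) powr (Q - 1))"])
           (use True b q in \<open>auto simp: norm_mult norm_of_real_powr simp del: of_real_diff\<close>)
      have "G y = (\<lambda>(s, t). (a s * of_real y powr (p s - 1)) * (b t * of_real (z - y) powr (q t - 1)))"
        using True by (auto simp: G_def k_def)
      thus ?thesis
        using ST.has_bochner_integral_pair_mult[OF 1 2] True
        by (simp add: has_bochner_integral_iff)
    qed (simp add: G_def k_def case_prod_unfold)
  qed
  finally show "has_bochner_integral lborel
      (\<lambda>y. indicator {0<..<z} y *\<^sub>R ((\<integral>s. a s * of_real y powr (p s - 1) \<partial>S) *
                                     (\<integral>t. b t * of_real (z - y) powr (q t - 1) \<partial>T)))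
      (\<integral>(s, t). a s * b t * Beta (p s) (q t) * of_real z powr (p s + q t - 1) \<partial>(S \<Otimes>\<^sub>M T))" .
qed

subsection \<open>Mellin--Barnes representation of the density\<close>

text \<open>The coefficient of \<open>y powr (\<zeta> - 1)\<close> in the Mellin-Barnes integral of
  one density. The factor \<open>2 * pi\<close> in the denominator is there because integration is
  over the real parameter \<open>t\<close> of the line.\<close>

definition fisher_kernel :: "real \<Rightarrow> real \<Rightarrow> real \<Rightarrow> complex \<Rightarrow> complex" where
  "fisher_kernel x m ms \<zeta> =
     of_real x powr \<zeta> * Gamma (of_real m - \<zeta>) * Gamma (of_real ms + \<zeta>) / of_real (2 * pi * (Gamma m * Gamma ms))"

text \<open>The two Gamma arguments sum to \<open>m + ms\<close> for every \<open>\<zeta>\<close>,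
  so the factor \<open>Gamma (m + ms)\<close> of both Beta values cancels.\<close>

lemma fisher_kernel_Beta:
  assumes "m > 0" "ms > 0"
  shows "fisher_kernel x m ms \<zeta> =
           of_real x powr \<zeta> * Beta (of_real m - \<zeta>) (of_real ms + \<zeta>) / of_real (2 * pi * Beta m ms)"
proof -
  have "Gamma (m + ms) \<noteq> 0" using assms by (metis Gamma_real_pos add_pos_pos less_irrefl)
  thus ?thesis
    by (simp add: fisher_kernel_def Beta_def Gamma_complex_of_real flip: of_real_add)
qed

text \<open>On the line the power of \<open>x\<close> has constant modulus \<open>x powr c\<close>;
  what remains is a Beta function on a vertical line with real parts \<open>m - c\<close> and
  \<open>ms + c\<close>, both positive.\<close>

lemma integrable_fisher_kernel:
  assumes "x > 0" "ms > 0" "0 < c" "c < m"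
  shows "integrable lborel (\<lambda>t. fisher_kernel x m ms (of_real c + \<i> * of_real t))"
proof -
  have "integrable lborel (\<lambda>t. Beta (of_real (m - c) - \<i> * of_real t) (of_real (ms + c) + \<i> * of_real t) *
          of_real (x powr c / (2 * pi * Beta m ms)))"
    using assms by (intro integrable_mult_left integrable_Beta_vertical) auto
  thus ?thesis
    by (rule Bochner_Integration.integrable_bound)
       (use assms in \<open>auto simp: fisher_kernel_Beta norm_mult norm_divide norm_of_real_powr algebra_simps\<close>)
qed

text \<open>With \<open>D = (ms - 1) * gb\<close> one has \<open>m = x * D\<close> and
  \<open>m * y + D = D * (1 + x * y)\<close>, and all powers of \<open>D\<close> cancel. The result
  is the density of a beta prime variable with parameters \<open>m\<close> and \<open>ms\<close>,
  divided by \<open>x\<close>.\<close>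

lemma fisher_snedecor_density_exp:
  assumes "gb > 0" "m > 0" "ms > 1" "y > 0"
  defines "x \<equiv> m / ((ms - 1) * gb)"
  shows "fisher_snedecor_density gb m ms y =
           exp (m * ln (x * y) - ln y - (m + ms) * ln (1 + x * y)) / Beta m ms"
proof -
  define D where "D = (ms - 1) * gb"
  have D: "D > 0" and x: "x > 0" and mx: "m = x * D" using assms by (auto simp: D_def x_def)
  have lnD: "ln (ms - 1) = ln D - ln gb" unfolding D_def using assms by (simp add: ln_mult)
  have xy: "1 + x * y > 0" using x assms by (simp add: add_pos_pos)
  have "m * y + D = D * (1 + x * y)" by (simp add: mx algebra_simps)
  hence "ln (m * y + D) = ln D + ln (1 + x * y)" using D xy by (simp add: ln_mult)
  moreover have "m * y + D > 0" using assms D by (simp add: add_pos_pos)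
  moreover have "ln m = ln x + ln D" unfolding mx using x D by (simp add: ln_mult)
  ultimately have "fisher_snedecor_density gb m ms y =
      exp (m * (ln x + ln D)) * exp (ms * (ln D - ln gb)) * exp (ms * ln gb) * exp ((m - 1) * ln y) /
        exp ((m + ms) * (ln D + ln (1 + x * y))) / Beta m ms"
    using assms D by (simp add: fisher_snedecor_density_def powr_def lnD D_def)
  also have "\<dots> = exp (m * (ln x + ln D) + ms * (ln D - ln gb) + ms * ln gb + (m - 1) * ln y
                  - (m + ms) * (ln D + ln (1 + x * y))) / Beta m ms"
    unfolding exp_add exp_diff ..
  also have "m * (ln x + ln D) + ms * (ln D - ln gb) + ms * ln gb + (m - 1) * ln y
                  - (m + ms) * (ln D + ln (1 + x * y)) = m * ln (x * y) - ln y - (m + ms) * ln (1 + x * y)"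
    using x assms(4) by (simp add: ln_mult algebra_simps)
  finally show ?thesis .
qed

lemma fisher_snedecor_density_Mellin_Barnes:
  assumes "gb > 0" "m > 0" "ms > 1" "y > 0" "0 < c" "c < m"
  shows "complex_of_real (fisher_snedecor_density gb m ms y) =
    (CLBINT t. fisher_kernel (m / ((ms - 1) * gb)) m ms (of_real c + \<i> * of_real t) *
               of_real y powr (of_real c + \<i> * of_real t - 1))"
proof -
  define x where "x = m / ((ms - 1) * gb)"
  define s where "s = ln (x * y)"
  have x: "x > 0" using assms by (simp add: x_def)
  have s: "s = ln x + ln y" "exp s = x * y" using x assms by (simp_all add: s_def ln_mult exp_add)
  let ?B = "\<lambda>t. Beta (of_real (m - c) - \<i> * of_real t) (of_real (ms + c) + \<i> * of_real t)"
  have eq: "fisher_kernel x m ms (of_real c + \<i> * of_real t) * of_real y powr (of_real c + \<i> * of_real t - 1) =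
      of_real (exp (c * s - ln y) / (2 * pi * Beta m ms)) * (iexp (t * s) * ?B t)" for t
  proof -
    have "complex_of_real x powr (of_real c + \<i> * of_real t) * of_real y powr (of_real c + \<i> * of_real t - 1) =
            exp (of_real (c * s - ln y)) * iexp (t * s)"
      using x assms unfolding s(1)
      by (simp add: powr_def Ln_of_real algebra_simps flip: exp_add)
    thus ?thesis using assms
      by (simp add: fisher_kernel_Beta algebra_simps flip: exp_of_real)
  qed
  have "fisher_snedecor_density gb m ms y = exp (m * s - ln y - (m + ms) * ln (1 + exp s)) / Beta m ms"
    unfolding s(2) using fisher_snedecor_density_exp[of gb m ms y] assms by (simp add: x_def s_def)
  \<comment> \<open>Splitting off \<open>exp (c * s)\<close> selects the line with abscissa
    \<open>c\<close>: the Beta parameters become \<open>m - c\<close> and \<open>ms + c\<close>,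
    with unchanged sum.\<close>
  also have "\<dots> = exp (c * s - ln y) / Beta m ms * exp ((m - c) * s - (m - c + (ms + c)) * ln (1 + exp s))"
    by (simp add: algebra_simps flip: exp_add)
  also have "complex_of_real \<dots> = of_real (exp (c * s - ln y) / Beta m ms) *
      ((CLBINT t. iexp (t * s) * ?B t) / (2 * pi))"
    unfolding of_real_mult using assms by (subst Beta_vertical_inversion) auto
  also have "\<dots> = (CLBINT t. of_real (exp (c * s - ln y) / (2 * pi * Beta m ms)) * (iexp (t * s) * ?B t))"
    by simp
  finally show ?thesis unfolding eq x_def [symmetric] .
qed

text \<open>The product measure is determined by its values on boxes, and the preimage of a box
  under the update map is a box in the old coordinates times the side in the new one.\<close>

lemma (in product_sigma_finite) distr_PiM_insert:
  assumes "finite I" "i \<notin> I"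
  shows "distr (Pi\<^sub>M I M \<Otimes>\<^sub>M M i) (Pi\<^sub>M (insert i I) M) (\<lambda>(t, u). t(i := u)) = Pi\<^sub>M (insert i I) M"
proof (rule PiM_eqI)
  interpret I: finite_product_sigma_finite M I by standard fact
  fix A assume A: "\<And>j. j \<in> insert i I \<Longrightarrow> A j \<in> sets (M j)"
  have "(\<lambda>(t, u). t(i := u)) -` Pi\<^sub>E (insert i I) A \<inter> space (Pi\<^sub>M I M \<Otimes>\<^sub>M M i) = Pi\<^sub>E I A \<times> A i"
    (is "?lhs = ?rhs")
  proof (intro equalityI subsetI; clarify)
    fix t u assume "(t, u) \<in> space (Pi\<^sub>M I M \<Otimes>\<^sub>M M i)" and *: "t(i := u) \<in> Pi\<^sub>E (insert i I) A"
    hence t: "t \<in> extensional I" by (auto simp: space_PiM space_pair_measure PiE_def)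
    have "t j \<in> A j" if "j \<in> I" for j
      using PiE_mem[OF *, of j] that assms(2) by (cases "j = i") auto
    moreover have "u \<in> A i" using PiE_mem[OF *, of i] by simp
    ultimately show "t \<in> Pi\<^sub>E I A \<and> u \<in> A i" using t by (auto simp: PiE_def)
  next
    fix t u assume t: "t \<in> Pi\<^sub>E I A" and u: "u \<in> A i"
    have "t \<in> space (Pi\<^sub>M I M)" "u \<in> space (M i)"
      using A[THEN sets.sets_into_space] t u by (auto simp: space_PiM PiE_iff)
    moreover have "t(i := u) \<in> Pi\<^sub>E (insert i I) A" using PiE_fun_upd[OF u t] .
    ultimately show "(t, u) \<in> ?lhs" by (simp add: space_pair_measure)
  qed
  thus "emeasure (distr (Pi\<^sub>M I M \<Otimes>\<^sub>M M i) (Pi\<^sub>M (insert i I) M) (\<lambda>(t, u). t(i := u))) (Pi\<^sub>E (insert i I) A) =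
      (\<Prod>j\<in>insert i I. emeasure (M j) (A j))"
    using A assms
    by (subst emeasure_distr)
       (auto simp: M.emeasure_pair_measure_Times I.measure_times mult.commute intro!: sets_PiM_I_finite)
qed (use assms in auto)

subsection \<open>The kernel of the sum\<close>

lemma fisher_snedecor_density_nonneg:
  assumes "m > 0" "ms > 0"
  shows "fisher_snedecor_density gb m ms y \<ge> 0"
  using assms by (auto simp: fisher_snedecor_density_def Beta_def)

definition contour_point :: "(nat \<Rightarrow> real) \<Rightarrow> (nat \<Rightarrow> real) \<Rightarrow> nat \<Rightarrow> complex" where
  "contour_point cc t k = of_real (cc k) + \<i> * of_real (t k)"

text \<open>The coefficient of z to the power (sum of the \<open>\<zeta>\<close> values) - 1 in the
  \<open>n\<close>-fold convolution, with the Beta factors of the successive convolutions already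
  telescoped into Gamma functions.\<close>

definition fisher_sum_kernel ::
  "(nat \<Rightarrow> real) \<Rightarrow> (nat \<Rightarrow> real) \<Rightarrow> (nat \<Rightarrow> real) \<Rightarrow> (nat \<Rightarrow> real) \<Rightarrow> nat \<Rightarrow> (nat \<Rightarrow> real) \<Rightarrow> complex" where
  "fisher_sum_kernel x m ms cc n t =
     (\<Prod>k<n. fisher_kernel (x k) (m k) (ms k) (contour_point cc t k) * Gamma (contour_point cc t k))
     / Gamma (\<Sum>k<n. contour_point cc t k)"

lemma Re_contour_point [simp]: "Re (contour_point cc t k) = cc k"
  by (simp add: contour_point_def)

lemma sum_contour_point_update:
  "(\<Sum>k<n. contour_point cc (t(n := u)) k) = (\<Sum>k<n. contour_point cc t k)"
  by (rule sum.cong) (auto simp: contour_point_def)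

lemma borel_measurable_contour_point [measurable]:
  "k \<in> I \<Longrightarrow> (\<lambda>t. contour_point cc t k) \<in> borel_measurable (Pi\<^sub>M I (\<lambda>_. lborel))"
  unfolding contour_point_def by measurable

lemma borel_measurable_fisher_kernel [measurable]:
  "fisher_kernel x m ms \<in> borel_measurable borel"
  unfolding fisher_kernel_def by measurable

lemma borel_measurable_fisher_sum_kernel [measurable]:
  "fisher_sum_kernel x m ms cc n \<in> borel_measurable (Pi\<^sub>M {..<n} (\<lambda>_. lborel))"
proof -
  have "(\<lambda>t. fisher_kernel (x k) (m k) (ms k) (contour_point cc t k) * Gamma (contour_point cc t k))
           \<in> borel_measurable (Pi\<^sub>M {..<n} (\<lambda>_. lborel))" if "k < n" for k
    using that by (intro borel_measurable_times
       measurable_compose[OF borel_measurable_contour_point borel_measurable_Gamma_complex]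
       measurable_compose[OF borel_measurable_contour_point borel_measurable_fisher_kernel]) auto
  moreover have "(\<lambda>t. \<Sum>k<n. contour_point cc t k) \<in> borel_measurable (Pi\<^sub>M {..<n} (\<lambda>_. lborel))"
    by measurable
  ultimately show ?thesis
    unfolding fisher_sum_kernel_def [abs_def]
    by (intro borel_measurable_divide borel_measurable_prod measurable_compose[OF _ borel_measurable_Gamma_complex]) auto
qed

lemma Gamma_Re_pos_nonzero: "Re z > 0 \<Longrightarrow> Gamma z \<noteq> 0"
  by (simp add: Gamma_eq_zero_iff Re_pos_not_nonpos_Int)

text \<open>One telescoping step: the Gamma value of the old sum in the numerator of
  \<open>Beta\<close> cancels the old denominator. It is nonzero because the old sum has positive
  real part; for \<open>n = 0\<close> that sum would be the pole 0.\<close>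

lemma fisher_sum_kernel_Suc:
  assumes "n \<ge> 1" "\<And>k. k < n \<Longrightarrow> cc k > 0"
  shows "fisher_sum_kernel x m ms cc (Suc n) (t(n := u)) =
    fisher_sum_kernel x m ms cc n t * fisher_kernel (x n) (m n) (ms n) (of_real (cc n) + \<i> * of_real u) *
      Beta (\<Sum>k<n. contour_point cc t k) (of_real (cc n) + \<i> * of_real u)"
proof -
  have "Re (\<Sum>k<n. contour_point cc t k) = (\<Sum>k<n. cc k)" by simp
  also have "\<dots> > 0" using assms by (intro sum_pos) (auto simp: lessThan_empty_iff)
  finally have "Gamma (\<Sum>k<n. contour_point cc t k) \<noteq> 0" by (rule Gamma_Re_pos_nonzero)
  moreover have "(\<Prod>k<n. fisher_kernel (x k) (m k) (ms k) (contour_point cc (t(n := u)) k) *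
                      Gamma (contour_point cc (t(n := u)) k)) =
     (\<Prod>k<n. fisher_kernel (x k) (m k) (ms k) (contour_point cc t k) * Gamma (contour_point cc t k))"
    by (rule prod.cong) (auto simp: contour_point_def)
  moreover have "contour_point cc (t(n := u)) n = of_real (cc n) + \<i> * of_real u"
    by (simp add: contour_point_def)
  ultimately show ?thesis
    by (simp add: fisher_sum_kernel_def sum_contour_point_update Beta_def)
qed

section \<open>Integration over the contours, one coordinate at a time\<close>

lemma distr_PiM_lessThan_Suc:
  "distr (Pi\<^sub>M {..<n} (\<lambda>_. lborel) \<Otimes>\<^sub>M lborel) (Pi\<^sub>M {..<Suc n} (\<lambda>_. lborel)) (\<lambda>(t, u). t(n := u)) =
     Pi\<^sub>M {..<Suc n} (\<lambda>_. lborel :: real measure)"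
proof -
  interpret product_sigma_finite "\<lambda>_::nat. lborel :: real measure" ..
  show ?thesis using distr_PiM_insert[of "{..<n}" n] by (simp flip: lessThan_Suc)
qed

text \<open>Each new contour multiplies the kernel by an integrable factor and a Beta factor, which
  is the situation of \<open>integrable_Beta_product\<close>; the result is then carried to the
  larger product space along the update map.\<close>

lemma integrable_fisher_sum_kernel:
  assumes "n \<ge> 1"
    and par: "\<And>k. k < n \<Longrightarrow> x k > 0 \<and> ms k > 0 \<and> 0 < cc k \<and> cc k < m k"
  shows "integrable (Pi\<^sub>M {..<n} (\<lambda>_. lborel)) (fisher_sum_kernel x m ms cc n)"
  using assms
proof (induction n rule: nat_induct_at_least)
  case base
  interpret product_sigma_finite "\<lambda>_::nat. lborel :: real measure" ..
  \<comment> \<open>For one contour the Gamma factors in numerator and denominator cancel, leaving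
    \<open>fisher_kernel\<close> alone.\<close>
  have "Gamma (contour_point cc t 0) \<noteq> 0" for t
    using base by (intro Gamma_Re_pos_nonzero) auto
  hence eq: "fisher_sum_kernel x m ms cc 1 = (\<lambda>t. fisher_kernel (x 0) (m 0) (ms 0) (of_real (cc 0) + \<i> * of_real (t 0)))"
    by (auto simp: fisher_sum_kernel_def contour_point_def)
  have "integrable (distr (Pi\<^sub>M {0::nat} (\<lambda>_. lborel)) lborel (\<lambda>t. t 0))
          (\<lambda>u. fisher_kernel (x 0) (m 0) (ms 0) (of_real (cc 0) + \<i> * of_real u))"
    using integrable_fisher_kernel[of "x 0" "ms 0" "cc 0" "m 0"] base by (subst distr_singleton) auto
  moreover have "{..<1} = {0::nat}" by auto
  ultimately show ?case unfolding eq by (subst (asm) integrable_distr_eq) auto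
next
  case (Suc n)
  interpret product_sigma_finite "\<lambda>_::nat. lborel :: real measure" ..
  interpret n: finite_product_sigma_finite "\<lambda>_::nat. lborel :: real measure" "{..<n}" by standard auto
  have pos: "(\<Sum>k<n. cc k) > 0"
    using Suc by (intro sum_pos) (auto simp: lessThan_empty_iff)
  have "integrable (Pi\<^sub>M {..<n} (\<lambda>_. lborel) \<Otimes>\<^sub>M lborel) (\<lambda>(t, u). fisher_sum_kernel x m ms cc n t *
      fisher_kernel (x n) (m n) (ms n) (of_real (cc n) + \<i> * of_real u) *
      Beta (\<Sum>k<n. contour_point cc t k) (of_real (cc n) + \<i> * of_real u))"
    using pos Suc by (intro integrable_Beta_product[where P = "\<Sum>k<n. cc k" and Q = "cc n"] integrable_fisher_kernel)
                     (auto intro: n.sigma_finite_measure_axioms sigma_finite_lborel)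
  also have "(\<lambda>(t, u). fisher_sum_kernel x m ms cc n t *
      fisher_kernel (x n) (m n) (ms n) (of_real (cc n) + \<i> * of_real u) *
      Beta (\<Sum>k<n. contour_point cc t k) (of_real (cc n) + \<i> * of_real u)) =
      (\<lambda>w. fisher_sum_kernel x m ms cc (Suc n) (case w of (t, u) \<Rightarrow> t(n := u)))"
    using Suc by (auto simp: fisher_sum_kernel_Suc)
  finally have "integrable (distr (Pi\<^sub>M {..<n} (\<lambda>_. lborel) \<Otimes>\<^sub>M lborel) (Pi\<^sub>M {..<Suc n} (\<lambda>_. lborel))
      (\<lambda>(t, u). t(n := u))) (fisher_sum_kernel x m ms cc (Suc n))"
    using measurable_add_dim[of n "{..<n}" "\<lambda>_. lborel :: real measure"]
    by (subst integrable_distr_eq) (simp_all flip: lessThan_Suc)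
  thus ?case by (simp only: distr_PiM_lessThan_Suc)
qed

lemma integral_PiM_lessThan_Suc:
  fixes f :: "(nat \<Rightarrow> real) \<Rightarrow> complex"
  assumes "f \<in> borel_measurable (Pi\<^sub>M {..<Suc n} (\<lambda>_. lborel))"
  shows "integral\<^sup>L (Pi\<^sub>M {..<Suc n} (\<lambda>_. lborel)) f =
           (\<integral>(t, u). f (t(n := u)) \<partial>(Pi\<^sub>M {..<n} (\<lambda>_. lborel) \<Otimes>\<^sub>M lborel))"
proof -
  have "integral\<^sup>L (Pi\<^sub>M {..<Suc n} (\<lambda>_. lborel)) f =
     integral\<^sup>L (distr (Pi\<^sub>M {..<n} (\<lambda>_. lborel) \<Otimes>\<^sub>M lborel) (Pi\<^sub>M {..<Suc n} (\<lambda>_. lborel)) (\<lambda>(t, u). t(n := u))) f"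
    by (simp only: distr_PiM_lessThan_Suc)
  also have "\<dots> = (\<integral>w. f (case w of (t, u) \<Rightarrow> t(n := u)) \<partial>(Pi\<^sub>M {..<n} (\<lambda>_. lborel) \<Otimes>\<^sub>M lborel))"
    using measurable_add_dim[of n "{..<n}" "\<lambda>_. lborel"] assms
    by (intro integral_distr) (simp_all flip: lessThan_Suc)
  finally show ?thesis by (simp add: case_prod_unfold)
qed

section \<open>The density of the sum, by induction on the number of summands\<close>

text \<open>The induction convolves the density of the partial sum with that of the next summand. A
  single \<open>F\<close> serves all admissible abscissae. Its nonnegativity and its vanishing for
  \<open>z \<le> 0\<close> are carried along to confine the convolution to \<open>{0<..<z}\<close>
  and to pass between real and \<open>ennreal\<close> integrals.\<close>

lemma sum_fisher_snedecor_density: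
  fixes \<gamma> :: "nat \<Rightarrow> 'a \<Rightarrow> real"
  assumes "prob_space M"
    and "n \<ge> 1"
    and "\<And>l. l < n \<Longrightarrow> gb l > 0 \<and> m l > 0 \<and> ms l > 1"
    and "prob_space.indep_vars M (\<lambda>_. borel) \<gamma> {..<n}"
    and "\<And>l. l < n \<Longrightarrow>
           distributed M lborel (\<gamma> l) (\<lambda>g. ennreal (fisher_snedecor_density (gb l) (m l) (ms l) g))"
  defines "x \<equiv> \<lambda>k. m k / ((ms k - 1) * gb k)"
  shows "\<exists>F. distributed M lborel (\<lambda>\<omega>. \<Sum>l<n. \<gamma> l \<omega>) (\<lambda>z. ennreal (F z)) \<and>
           (\<forall>z. F z \<ge> 0) \<and> (\<forall>z\<le>0. F z = 0) \<and>
           (\<forall>z>0. \<forall>cc. (\<forall>k<n. 0 < cc k \<and> cc k < m k) \<longrightarrow>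
              complex_of_real (F z) =
                (\<integral>t. fisher_sum_kernel x m ms cc n t * of_real z powr ((\<Sum>k<n. contour_point cc t k) - 1)
                   \<partial>Pi\<^sub>M {..<n} (\<lambda>_. lborel)))"
  using assms(2-5)
proof (induction n rule: nat_induct_at_least)
  case base
  interpret product_sigma_finite "\<lambda>_::nat. lborel :: real measure" ..
  let ?F = "fisher_snedecor_density (gb 0) (m 0) (ms 0)"
  have par: "gb 0 > 0" "m 0 > 0" "ms 0 > 1" using base by auto
  have "complex_of_real (?F z) =
     (\<integral>t. fisher_sum_kernel x m ms cc 1 t * of_real z powr ((\<Sum>k<1. contour_point cc t k) - 1)
                   \<partial>Pi\<^sub>M {..<1} (\<lambda>_. lborel))" if z: "z > 0" and cc: "0 < cc 0" "cc 0 < m 0" for z cc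
  proof -
    have "Gamma (contour_point cc t 0) \<noteq> 0" for t
      using cc by (intro Gamma_Re_pos_nonzero) auto
    hence eq: "fisher_sum_kernel x m ms cc 1 t * of_real z powr ((\<Sum>k<1. contour_point cc t k) - 1) =
        fisher_kernel (x 0) (m 0) (ms 0) (of_real (cc 0) + \<i> * of_real (t 0)) *
          of_real z powr (of_real (cc 0) + \<i> * of_real (t 0) - 1)" for t
      by (auto simp: fisher_sum_kernel_def contour_point_def)
    have 0: "{..<1} = {0::nat}" by auto
    show ?thesis unfolding eq unfolding 0
      using product_integral_singleton[of "\<lambda>u. fisher_kernel (x 0) (m 0) (ms 0) (of_real (cc 0) + \<i> * of_real u) *
          of_real z powr (of_real (cc 0) + \<i> * of_real u - 1)" 0]
      using fisher_snedecor_density_Mellin_Barnes[of "gb 0" "m 0" "ms 0" z "cc 0"] par z cc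
      by (simp add: x_def)
  qed
  moreover have "?F z \<ge> 0" for z using par by (intro fisher_snedecor_density_nonneg) auto
  moreover have "?F z = 0" if "z \<le> 0" for z using that by (simp add: fisher_snedecor_density_def)
  moreover have "distributed M lborel (\<lambda>\<omega>. \<Sum>l<1. \<gamma> l \<omega>) (\<lambda>z. ennreal (?F z))"
    using base by simp
  ultimately show ?case by (intro exI[of _ ?F]) auto
next
  case (Suc n)
  interpret prob_space M by fact
  interpret product_sigma_finite "\<lambda>_::nat. lborel :: real measure" ..
  interpret n: finite_product_sigma_finite "\<lambda>_::nat. lborel :: real measure" "{..<n}" by standard auto
  let ?f = "fisher_snedecor_density (gb n) (m n) (ms n)"
  have par: "gb n > 0" "m n > 0" "ms n > 1" using Suc.prems by auto
  have indep: "indep_vars (\<lambda>_. borel) \<gamma> {..<n}"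
    using Suc.prems(2) by (rule indep_vars_subset) auto
  obtain F where dist: "distributed M lborel (\<lambda>\<omega>. \<Sum>l<n. \<gamma> l \<omega>) (\<lambda>z. ennreal (F z))"
    and F_nonneg: "\<And>z. F z \<ge> 0" and F_0: "\<And>z. z \<le> 0 \<Longrightarrow> F z = 0"
    and F: "\<And>z cc. z > 0 \<Longrightarrow> (\<And>k. k < n \<Longrightarrow> 0 < cc k \<and> cc k < m k) \<Longrightarrow>
       complex_of_real (F z) =
                (\<integral>t. fisher_sum_kernel x m ms cc n t * of_real z powr ((\<Sum>k<n. contour_point cc t k) - 1)
                   \<partial>Pi\<^sub>M {..<n} (\<lambda>_. lborel))"
    using Suc.IH[OF _ indep] Suc.prems by (auto simp: less_Suc_eq)
  define F' where "F' = (\<lambda>z. LBINT y. ?f (z - y) * F y)"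
  have f_nonneg: "?f y \<ge> 0" for y using par by (intro fisher_snedecor_density_nonneg) auto
  have f_0: "?f y = 0" if "y \<le> 0" for y using that by (simp add: fisher_snedecor_density_def)
  have conv: "has_bochner_integral lborel (\<lambda>y. complex_of_real (?f (z - y) * F y))
    (\<integral>t. fisher_sum_kernel x m ms cc (Suc n) t * of_real z powr ((\<Sum>k<Suc n. contour_point cc t k) - 1)
                   \<partial>Pi\<^sub>M {..<Suc n} (\<lambda>_. lborel))"
    if z: "z > 0" and cc: "\<And>k. k < Suc n \<Longrightarrow> 0 < cc k \<and> cc k < m k" for z cc
  proof -
    define \<zeta> where "\<zeta> = (\<lambda>u. complex_of_real (cc n) + \<i> * of_real u)"
    have [measurable]: "\<zeta> \<in> borel_measurable borel" unfolding \<zeta>_def by measurable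
    have pos: "(\<Sum>k<n. cc k) > 0"
      using Suc.hyps cc by (intro sum_pos) (auto simp: lessThan_empty_iff)
    have "has_bochner_integral lborel
      (\<lambda>y. indicator {0<..<z} y *\<^sub>R
         ((\<integral>t. fisher_sum_kernel x m ms cc n t * of_real y powr ((\<Sum>k<n. contour_point cc t k) - 1)
               \<partial>Pi\<^sub>M {..<n} (\<lambda>_. lborel)) *
          (\<integral>u. fisher_kernel (x n) (m n) (ms n) (\<zeta> u) * of_real (z - y) powr (\<zeta> u - 1) \<partial>lborel)))
      (\<integral>(t, u). fisher_sum_kernel x m ms cc n t * fisher_kernel (x n) (m n) (ms n) (\<zeta> u) *
            Beta (\<Sum>k<n. contour_point cc t k) (\<zeta> u) * of_real z powr ((\<Sum>k<n. contour_point cc t k) + \<zeta> u - 1)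
          \<partial>(Pi\<^sub>M {..<n} (\<lambda>_. lborel) \<Otimes>\<^sub>M lborel))"
    proof (rule Mellin_convolution[where P = "\<Sum>k<n. cc k" and Q = "cc n"])
      show "integrable (Pi\<^sub>M {..<n} (\<lambda>_. lborel)) (fisher_sum_kernel x m ms cc n)"
        using Suc.prems(1) cc Suc.hyps
        by (intro integrable_fisher_sum_kernel) (force simp: x_def less_Suc_eq)+
      show "integrable lborel (\<lambda>u. fisher_kernel (x n) (m n) (ms n) (\<zeta> u))"
        unfolding \<zeta>_def using par cc[of n] by (intro integrable_fisher_kernel) (auto simp: x_def)
    qed (use pos z cc[of n] in \<open>auto simp: \<zeta>_def intro: n.sigma_finite_measure_axioms sigma_finite_lborel\<close>)
    also have "(\<lambda>y. indicator {0<..<z} y *\<^sub>R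
         ((\<integral>t. fisher_sum_kernel x m ms cc n t * of_real y powr ((\<Sum>k<n. contour_point cc t k) - 1)
               \<partial>Pi\<^sub>M {..<n} (\<lambda>_. lborel)) *
          (\<integral>u. fisher_kernel (x n) (m n) (ms n) (\<zeta> u) * of_real (z - y) powr (\<zeta> u - 1) \<partial>lborel))) =
       (\<lambda>y. complex_of_real (?f (z - y) * F y))"
    proof
      fix y
      show "indicator {0<..<z} y *\<^sub>R
         ((\<integral>t. fisher_sum_kernel x m ms cc n t * of_real y powr ((\<Sum>k<n. contour_point cc t k) - 1)
               \<partial>Pi\<^sub>M {..<n} (\<lambda>_. lborel)) *
          (\<integral>u. fisher_kernel (x n) (m n) (ms n) (\<zeta> u) * of_real (z - y) powr (\<zeta> u - 1) \<partial>lborel)) =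
         complex_of_real (?f (z - y) * F y)"
      \<comment> \<open>Inside the interval both \<open>y\<close> and \<open>z - y\<close> are
        positive and both contour representations apply; outside it one of the two densities
        vanishes.\<close>
      proof (cases "y \<in> {0<..<z}")
        case True
        have "complex_of_real (F y) = (\<integral>t. fisher_sum_kernel x m ms cc n t *
            of_real y powr ((\<Sum>k<n. contour_point cc t k) - 1) \<partial>Pi\<^sub>M {..<n} (\<lambda>_. lborel))"
          using True cc by (intro F) auto
        moreover have "complex_of_real (?f (z - y)) =
            (\<integral>u. fisher_kernel (x n) (m n) (ms n) (\<zeta> u) * of_real (z - y) powr (\<zeta> u - 1) \<partial>lborel)"
          unfolding x_def \<zeta>_def using True par cc[of n]
          by (intro fisher_snedecor_density_Mellin_Barnes) auto
        ultimately show ?thesis using True by simp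
      qed (auto simp: F_0 f_0 not_less)
    qed
    also have "(\<integral>(t, u). fisher_sum_kernel x m ms cc n t * fisher_kernel (x n) (m n) (ms n) (\<zeta> u) *
            Beta (\<Sum>k<n. contour_point cc t k) (\<zeta> u) * of_real z powr ((\<Sum>k<n. contour_point cc t k) + \<zeta> u - 1)
          \<partial>(Pi\<^sub>M {..<n} (\<lambda>_. lborel) \<Otimes>\<^sub>M lborel)) =
       (\<integral>(t, u). fisher_sum_kernel x m ms cc (Suc n) (t(n := u)) *
            of_real z powr ((\<Sum>k<Suc n. contour_point cc (t(n := u)) k) - 1)
          \<partial>(Pi\<^sub>M {..<n} (\<lambda>_. lborel) \<Otimes>\<^sub>M lborel))"
      using Suc.hyps cc unfolding \<zeta>_def
      by (intro Bochner_Integration.integral_cong refl)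
         (auto simp: fisher_sum_kernel_Suc sum_contour_point_update contour_point_def[of _ _ n])
    also have "\<dots> = (\<integral>t. fisher_sum_kernel x m ms cc (Suc n) t *
          of_real z powr ((\<Sum>k<Suc n. contour_point cc t k) - 1) \<partial>Pi\<^sub>M {..<Suc n} (\<lambda>_. lborel))"
    proof (rule integral_PiM_lessThan_Suc [symmetric])
      have [measurable]: "(\<lambda>t. \<Sum>k<Suc n. contour_point cc t k) \<in> borel_measurable (Pi\<^sub>M {..<Suc n} (\<lambda>_. lborel))"
        by measurable
      show "(\<lambda>t. fisher_sum_kernel x m ms cc (Suc n) t * of_real z powr ((\<Sum>k<Suc n. contour_point cc t k) - 1))
          \<in> borel_measurable (Pi\<^sub>M {..<Suc n} (\<lambda>_. lborel))"
        by measurable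
    qed
    finally show ?thesis .
  qed
  have F': "complex_of_real (F' z) =
     (\<integral>t. fisher_sum_kernel x m ms cc (Suc n) t * of_real z powr ((\<Sum>k<Suc n. contour_point cc t k) - 1)
                   \<partial>Pi\<^sub>M {..<Suc n} (\<lambda>_. lborel))"
    if z: "z > 0" and cc: "\<And>k. k < Suc n \<Longrightarrow> 0 < cc k \<and> cc k < m k" for z cc
    using conv[OF z cc] unfolding F'_def by (simp only: has_bochner_integral_iff integral_complex_of_real)
  have F'_0: "F' z = 0" if "z \<le> 0" for z
  proof -
    have 0: "?f (z - y) * F y = 0" for y using that F_0[of y] f_0[of "z - y"] by (cases "y \<le> 0") auto
    show ?thesis unfolding F'_def 0 by simp
  qed
  have nn: "(\<integral>\<^sup>+y. ennreal (?f (z - y)) * ennreal (F y) \<partial>lborel) = ennreal (F' z)" for z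
  proof (cases "z > 0")
    case True
    \<comment> \<open>Integrability of the convolution integrand is read off from the contour
      formula at one admissible choice of abscissae, the midpoints \<open>m k / 2\<close>.\<close>
    have "integrable lborel (\<lambda>y. complex_of_real (?f (z - y) * F y))"
      by (rule integrable.intros, rule conv[OF True, of "\<lambda>k. m k / 2"])
         (use Suc.prems(1) in force)
    hence "integrable lborel (\<lambda>y. ?f (z - y) * F y)"
      by (simp only: complex_of_real_integrable_eq)
    thus ?thesis
      unfolding F'_def using f_nonneg F_nonneg
      by (subst nn_integral_eq_integral [symmetric]) (simp_all add: ennreal_mult)
  next
    case False
    have 0: "ennreal (?f (z - y)) * ennreal (F y) = 0" for y
      using False F_0[of y] f_0[of "z - y"] by (cases "y \<le> 0") auto
    show ?thesis unfolding 0 using False by (simp add: F'_0)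
  qed
  have "distributed M lborel (\<lambda>\<omega>. \<gamma> n \<omega> + (\<Sum>l<n. \<gamma> l \<omega>))
          (\<lambda>z. \<integral>\<^sup>+y. ennreal (?f (z - y)) * ennreal (F y) \<partial>lborel)"
  proof (rule distributed_convolution)
    show "indep_var borel (\<gamma> n) borel (\<lambda>\<omega>. \<Sum>l<n. \<gamma> l \<omega>)"
      using Suc.prems(2) by (intro indep_vars_sum) (auto simp: lessThan_Suc)
  qed (use Suc.prems(3) dist in auto)
  hence "distributed M lborel (\<lambda>\<omega>. \<Sum>l<Suc n. \<gamma> l \<omega>) (\<lambda>z. ennreal (F' z))"
    by (simp add: nn add.commute)
  moreover have "F' z \<ge> 0" for z
    unfolding F'_def using f_nonneg F_nonneg by (intro Bochner_Integration.integral_nonneg) auto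
  ultimately show ?case
    using F'_0 by (intro exI[of _ F'] conjI allI impI F') auto
qed

section \<open>Identification with the Fox H integrand\<close>

text \<open>With these parameter lists \<open>foxH_phi\<close> reduces to the product of the Gamma
  values at \<open>m k - \<zeta> k\<close>, \<open>\<zeta> k\<close> and
  \<open>ms k + \<zeta> k\<close>, and \<open>foxH_Psi\<close> to the reciprocal Gamma of the sum.
  The constants come from the normalisation of \<open>fisher_kernel\<close>, and the factor
  \<open>z\<close> from the exponent lowered by 1.\<close>

lemma foxH_integrand_eq:
  fixes x m ms cc t :: "nat \<Rightarrow> real"
  assumes z: "z > 0" and par: "\<And>k. k < n \<Longrightarrow> x k > 0 \<and> m k > 0 \<and> ms k > 0"
  defines "\<zeta> \<equiv> \<lambda>k. complex_of_real (cc k) + \<i> * complex_of_real (t k)"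
  shows "foxH_Psi n 0 [] [(1, \<lambda>_. 1)] \<zeta> *
     (\<Prod>k<n. foxH_phi 1 2 [(1, 1), (1 - complex_of_real (ms k), 1)] [(complex_of_real (m k), 1)] (\<zeta> k) *
              complex_of_real (x k * z) powr \<zeta> k) * \<i> ^ n =
   (2 * of_real pi * \<i>) ^ n * of_real (z * (\<Prod>l<n. Gamma (m l) * Gamma (ms l))) *
     (fisher_sum_kernel x m ms cc n t * of_real z powr ((\<Sum>k<n. contour_point cc t k) - 1))"
proof -
  have \<zeta>: "contour_point cc t = \<zeta>" by (auto simp: contour_point_def \<zeta>_def)
  have phi: "foxH_phi 1 2 [(1, 1), (1 - complex_of_real (ms k), 1)] [(complex_of_real (m k), 1)] (\<zeta> k) *
              complex_of_real (x k * z) powr \<zeta> k =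
      2 * of_real pi * of_real (Gamma (m k) * Gamma (ms k)) *
      (fisher_kernel (x k) (m k) (ms k) (\<zeta> k) * Gamma (\<zeta> k)) * of_real z powr \<zeta> k" if "k < n" for k
  proof -
    have nz: "Gamma (m k) \<noteq> 0" "Gamma (ms k) \<noteq> 0"
      using par[OF that] by (metis Gamma_real_pos less_irrefl)+
    \<comment> \<open>Both bases are positive reals, so the principal power is
      multiplicative.\<close>
    have "complex_of_real (x k * z) powr \<zeta> k = of_real (x k) powr \<zeta> k * of_real z powr \<zeta> k"
      using par[OF that] z by (simp add: powr_def Ln_of_real ln_mult algebra_simps flip: exp_add of_real_mult)
    thus ?thesis using nz
      by (simp add: foxH_phi_def fisher_kernel_def lessThan_Suc eval_nat_numeral)
  qed
  have pz: "of_real z powr ((\<Sum>k<n. \<zeta> k) - 1) = (\<Prod>k<n. of_real z powr \<zeta> k) / of_real z"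
    using z by (simp add: powr_diff powr_sum)
  have "(\<Prod>k<n. foxH_phi 1 2 [(1, 1), (1 - complex_of_real (ms k), 1)] [(complex_of_real (m k), 1)] (\<zeta> k) *
              complex_of_real (x k * z) powr \<zeta> k) =
      (\<Prod>k<n. 2 * of_real pi * of_real (Gamma (m k) * Gamma (ms k)) *
        (fisher_kernel (x k) (m k) (ms k) (\<zeta> k) * Gamma (\<zeta> k)) * of_real z powr \<zeta> k)"
    by (rule prod.cong) (use phi in auto)
  also have "\<dots> = (2 * of_real pi) ^ n * of_real (\<Prod>k<n. Gamma (m k) * Gamma (ms k)) *
      (\<Prod>k<n. fisher_kernel (x k) (m k) (ms k) (\<zeta> k) * Gamma (\<zeta> k)) * (\<Prod>k<n. of_real z powr \<zeta> k)"
    by (simp add: prod.distrib)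
  finally show ?thesis
    using z unfolding \<zeta> fisher_sum_kernel_def pz
    by (simp add: foxH_Psi_def power_mult_distrib)
qed

theorem theorem1:
  fixes M :: "'a measure" and L :: nat
    and \<gamma> :: "nat \<Rightarrow> 'a \<Rightarrow> real"
    and gb m msh :: "nat \<Rightarrow> real"
  assumes "prob_space M"
    and "L \<ge> 1"
    and "\<And>l. l < L \<Longrightarrow> gb l > 0 \<and> m l > 0 \<and> msh l > 1"
    and "prob_space.indep_vars M (\<lambda>_. borel) \<gamma> {..<L}"
    and "\<And>l. l < L \<Longrightarrow>
           distributed M lborel (\<gamma> l) (\<lambda>g. ennreal (fisher_snedecor_density (gb l) (m l) (msh l) g))"
  shows "\<exists>fZ :: real \<Rightarrow> real.
           distributed M lborel (\<lambda>\<omega>. \<Sum>l<L. \<gamma> l \<omega>) (\<lambda>z. ennreal (fZ z)) \<and>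
           (\<forall>z > 0. \<forall>cc :: nat \<Rightarrow> real. (\<forall>k<L. 0 < cc k \<and> cc k < m k) \<longrightarrow>
              complex_of_real (fZ z) =
                1 / complex_of_real (z * (\<Prod>l<L. Gamma (m l) * Gamma (msh l)))
                * foxH L 0 [] [(1, \<lambda>_. 1)]
                    (\<lambda>_. 1) (\<lambda>_. 2)
                    (\<lambda>k. [(1, 1), (1 - complex_of_real (msh k), 1)])
                    (\<lambda>k. [(complex_of_real (m k), 1)])
                    (\<lambda>k. complex_of_real (m k / ((msh k - 1) * gb k) * z))
                    cc)"
proof -
  define x where "x = (\<lambda>k. m k / ((msh k - 1) * gb k))"
  obtain F where dist: "distributed M lborel (\<lambda>\<omega>. \<Sum>l<L. \<gamma> l \<omega>) (\<lambda>z. ennreal (F z))"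
    and F: "\<And>z cc. z > 0 \<Longrightarrow> (\<And>k. k < L \<Longrightarrow> 0 < cc k \<and> cc k < m k) \<Longrightarrow>
       complex_of_real (F z) =
                (\<integral>t. fisher_sum_kernel x m msh cc L t * of_real z powr ((\<Sum>k<L. contour_point cc t k) - 1)
                   \<partial>Pi\<^sub>M {..<L} (\<lambda>_. lborel))"
    using sum_fisher_snedecor_density[OF assms] unfolding x_def by blast
  have main: "complex_of_real (F z) =
      1 / complex_of_real (z * (\<Prod>l<L. Gamma (m l) * Gamma (msh l)))
      * foxH L 0 [] [(1, \<lambda>_. 1)] (\<lambda>_. 1) (\<lambda>_. 2)
          (\<lambda>k. [(1, 1), (1 - complex_of_real (msh k), 1)])
          (\<lambda>k. [(complex_of_real (m k), 1)])
          (\<lambda>k. complex_of_real (x k * z)) cc"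
    if z: "z > 0" and cc: "\<And>k. k < L \<Longrightarrow> 0 < cc k \<and> cc k < m k" for z cc
  proof -
    have par: "x k > 0 \<and> m k > 0 \<and> msh k > 0" if "k < L" for k
      using assms(3)[OF that] by (auto simp: x_def)
    have "(\<Prod>l<L. Gamma (m l) * Gamma (msh l)) > 0"
      using par by (intro prod_pos) auto
    hence nz: "complex_of_real (z * (\<Prod>l<L. Gamma (m l) * Gamma (msh l))) \<noteq> 0"
      using z by (metis less_irrefl mult_pos_pos of_real_eq_0_iff)
    \<comment> \<open>The factor \<open>(2 * of_real pi * \<i>) ^ L\<close> collected in the
      integrand cancels the normalisation in front of the contour integral, so only the prefactor of
      the density remains.\<close>
    have "foxH L 0 [] [(1, \<lambda>_. 1)] (\<lambda>_. 1) (\<lambda>_. 2)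
          (\<lambda>k. [(1, 1), (1 - complex_of_real (msh k), 1)])
          (\<lambda>k. [(complex_of_real (m k), 1)])
          (\<lambda>k. complex_of_real (x k * z)) cc =
       (1 / (2 * of_real pi * \<i>)) ^ L * ((2 * of_real pi * \<i>) ^ L *
          of_real (z * (\<Prod>l<L. Gamma (m l) * Gamma (msh l))) * complex_of_real (F z))"
    proof -
      have "complex_of_real (F z) = (\<integral>t. fisher_sum_kernel x m msh cc L t *
          of_real z powr ((\<Sum>k<L. contour_point cc t k) - 1) \<partial>Pi\<^sub>M {..<L} (\<lambda>_. lborel))"
        by (rule F) (use z cc in auto)
      moreover note foxH_integrand_eq[where n = L and x = x and m = m and ms = msh and z = z and cc = cc, OF z par]
      ultimately show ?thesis
        unfolding foxH_def Let_def by (simp only: integral_mult_right_zero)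
    qed
    thus ?thesis using nz by (simp add: power_divide)
  qed
  show ?thesis
    by (intro exI[of _ F] conjI allI impI dist main[unfolded x_def]) auto
qed

end
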